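(* There exist universal constants $c_0, C > 0$ such that the following holds. Let $(D,\mathcal{D},\rho)$ be a probability space and let $\{\phi_i\}_{i\in\mathbb{N}}$ be a bounded Riesz basis of $L^2_\rho(D)$ with Riesz constants $a_\phi, b_\phi>0$ and bound $K_\phi<\infty$ (see context). Let $0<\varepsilon<1$, $s,n,m\in\mathbb{N}$, and let $x_1,\ldots,x_m$ be drawn i.i.d. from $\rho$, where $$ m \geq c_0 \cdot \frac{K_\phi^2}{a_\phi}\cdot s\cdot\left(\log^2\left(2\frac{K_\phi^2}{a_\phi}s\right)\log(2n)+\log(1/\varepsilon)\right). $$ Then the following holds with probability at least $1-\varepsilon$. For any $f\in L^2_\rho(D)$ that is defined everywhere, with coefficients $c=(c_i)_{i\in\mathbb{N}}$ (so $f=\sum_{i}c_i\phi_i$ in $L^2_\rho(D)$), $c_{[n]}=(c_i)_{i=1}^n$ and $f_n=\sum_{i=1}^n c_i\phi_i$, the approximation $\hat f=\mathcal{R}_{s,n}(f)$ is at most $2s$-sparse (a linear combination of at most $2s$ of the functions $\phi_1,\ldots,\phi_n$) and satisfies, for all $p\in[2,\infty]$, $$ \|f-\hat f\|_{L^p_\rho}\leq C\,(b_\phi)^{\frac1p}(K_\phi)^{1-\frac2p}\left(\frac{\sigma_s(c_{[n]})_1}{s^{\frac1p}}+\frac{s^{\frac12-\frac1p}}{\sqrt{a_\phi}}\,\|f-f_n\|_{L^\infty_\rho}\right). $$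
   Context: Bounded Riesz basis: $\{\phi_i\}_{i\in\mathbb{N}}$ is a Riesz basis of $L^2_\rho(D)$ (the space of complex-valued square-integrable functions on $D$), i.e. a family of functions $D\to\mathbb{C}$ whose linear span is dense in $L^2_\rho(D)$ with $a_\phi\|c\|_2^2\leq\|\sum_i c_i\phi_i\|_{L^2_\rho}^2\leq b_\phi\|c\|_2^2$ for all $c\in\ell^2(\mathbb{N})$, and $K_\phi=\sup_{i}\|\phi_i\|_{L^\infty_\rho}<\infty$. A vector is $s$-sparse if it has at most $s$ nonzero entries, and $\sigma_s(c)_p=\inf\{\|c-z\|_p : z \text{ is } s\text{-sparse}\}$. The sparse recovery procedure $\mathcal{R}_{s,n}$: given the samples $f(x_1),\ldots,f(x_m)$, set $b=\frac{1}{\sqrt m}(f(x_i))_{i=1}^m\in\mathbb{C}^m$ and $A=\frac{1}{\sqrt m}(\phi_j(x_i))_{i,j=1}^{m,n}\in\mathbb{C}^{m\times n}$. Let $\check c\in\mathbb{C}^n$ be the (unique) minimizer of smallest $\ell^2$-norm of the problem $\min_{z\in\mathbb{C}^n}\lambda\|z\|_1+\|Az-b\|_2$ with $\lambda=\frac{3}{14}\sqrt{a_\phi/s}$. Let $\hat c=H_{2s}(\check c)$, where $H_{2s}$ is hard thresholding, which keeps the $2s$ largest entries in absolute value and sets all others to zero. Then $\mathcal{R}_{s,n}(f)=\hat f=\sum_{i=1}^n\hat c_i\phi_i$. The convention $1/\infty=0$ is used.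
   Formalization: With the essential supremum of f−f_n the claim for all f at once fails (alter f at the sample points); here the bound for all f uses the supremum over D, the essential-supremum bound holds for each f almost surely on the event, and c_0, C are stated per underlying set D. *)

theory Defs
  imports "HOL-Probability.Probability"
begin

text \<open>Elements of the \<open>L\<^sup>p\<close> spaces are functions \<open>'a \<Rightarrow> complex\<close> defined everywhere (not
  equivalence classes), so that point samples make sense. The exponent ranges over the
  extended nonnegative reals; for \<open>p = \<infinity>\<close> the norm is the essential supremum.\<close>

definition Lp_norm :: "'a measure \<Rightarrow> ennreal \<Rightarrow> ('a \<Rightarrow> complex) \<Rightarrow> ennreal" where
  "Lp_norm M p f =
    (if p = \<infinity> then esssup M (\<lambda>t. ennreal (cmod (f t)))
     else let I = (\<integral>\<^sup>+ t. ennreal (cmod (f t) powr enn2real p) \<partial>M)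
          in if I = \<infinity> then \<infinity> else ennreal (enn2real I powr (1 / enn2real p)))"

definition Lp_space :: "'a measure \<Rightarrow> ennreal \<Rightarrow> ('a \<Rightarrow> complex) set" where
  "Lp_space M p = {f \<in> borel_measurable M. Lp_norm M p f < \<infinity>}"

text \<open>An error bound holding for all everywhere-defined \<open>f\<close> at once on a common event of sampling
  points cannot use the essential supremum of \<open>f - f\<^sub>n\<close>, since \<open>f\<close> may be changed on the (null) set of
  sampling points. The supremum over the whole domain is used there; the essential supremum is
  admissible for each \<open>f\<close> outside a null set of sampling points depending on \<open>f\<close>.\<close>

definition sup_norm :: "'a measure \<Rightarrow> ('a \<Rightarrow> complex) \<Rightarrow> ennreal" where
  "sup_norm M f = (SUP t\<in>space M. ennreal (cmod (f t)))"

definition lincomb :: "(nat \<Rightarrow> 'a \<Rightarrow> complex) \<Rightarrow> nat set \<Rightarrow> (nat \<Rightarrow> complex) \<Rightarrow> 'a \<Rightarrow> complex" where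
  "lincomb \<phi> J c t = (\<Sum>j\<in>J. c j * \<phi> j t)"

text \<open>\<open>f = \<Sum>\<^sub>i c\<^sub>i \<phi>\<^sub>i\<close> with convergence in \<open>L\<^sup>2\<close>.\<close>

definition L2_sums ::
  "'a measure \<Rightarrow> (nat \<Rightarrow> 'a \<Rightarrow> complex) \<Rightarrow> (nat \<Rightarrow> complex) \<Rightarrow> ('a \<Rightarrow> complex) \<Rightarrow> bool" where
  "L2_sums M \<phi> c f \<longleftrightarrow>
    f \<in> Lp_space M 2 \<and>
    (\<lambda>N. Lp_norm M 2 (\<lambda>t. f t - lincomb \<phi> {..<N} c t)) \<longlonglongrightarrow> 0"

text \<open>\<open>a\<close> and \<open>b\<close> are any constants for which the two-sided estimate holds; \<open>K\<close> is the exact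
  supremum of the \<open>L\<^sup>\<infinity>\<close> norms.\<close>

definition bounded_riesz_basis ::
  "'a measure \<Rightarrow> (nat \<Rightarrow> 'a \<Rightarrow> complex) \<Rightarrow> real \<Rightarrow> real \<Rightarrow> real \<Rightarrow> bool" where
  "bounded_riesz_basis M \<phi> a b K \<longleftrightarrow>
    0 < a \<and> 0 < b \<and> 0 \<le> K \<and>
    (\<forall>i. \<phi> i \<in> Lp_space M 2) \<and>
    (\<forall>g\<in>Lp_space M 2. \<forall>e>0. \<exists>N d. Lp_norm M 2 (\<lambda>t. g t - lincomb \<phi> {..<N} d t) < e) \<and>
    (\<forall>c. summable (\<lambda>i. (cmod (c i))\<^sup>2) \<longrightarrow>
      (\<exists>g. L2_sums M \<phi> c g \<and>
        ennreal (a * (\<Sum>i. (cmod (c i))\<^sup>2)) \<le> (Lp_norm M 2 g)\<^sup>2 \<and>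
        (Lp_norm M 2 g)\<^sup>2 \<le> ennreal (b * (\<Sum>i. (cmod (c i))\<^sup>2)))) \<and>
    (SUP i. Lp_norm M \<infinity> (\<phi> i)) = ennreal K"

text \<open>\<open>\<complex>\<^sup>n\<close>, with entries indexed by \<open>0, \<dots>, n - 1\<close> and padded by zeros.\<close>

definition cvec :: "nat \<Rightarrow> (nat \<Rightarrow> complex) set" where
  "cvec n = {z. \<forall>i\<ge>n. z i = 0}"

definition l1_norm :: "nat \<Rightarrow> (nat \<Rightarrow> complex) \<Rightarrow> real" where
  "l1_norm n z = (\<Sum>i<n. cmod (z i))"

definition l2_norm :: "nat \<Rightarrow> (nat \<Rightarrow> complex) \<Rightarrow> real" where
  "l2_norm n z = L2_set (\<lambda>i. cmod (z i)) {..<n}"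

definition sparse :: "nat \<Rightarrow> nat \<Rightarrow> (nat \<Rightarrow> complex) \<Rightarrow> bool" where
  "sparse n s z \<longleftrightarrow> z \<in> cvec n \<and> card {i. z i \<noteq> 0} \<le> s"

text \<open>\<open>\<sigma>\<^sub>s(c\<^sub>[\<^sub>n\<^sub>])\<^sub>1\<close>: only the first \<open>n\<close> entries of \<open>c\<close> enter.\<close>

definition sigma1 :: "nat \<Rightarrow> nat \<Rightarrow> (nat \<Rightarrow> complex) \<Rightarrow> real" where
  "sigma1 n s c = (INF z\<in>{z. sparse n s z}. l1_norm n (\<lambda>i. c i - z i))"

definition sqrt_lasso ::
  "real \<Rightarrow> nat \<Rightarrow> nat \<Rightarrow> (nat \<Rightarrow> nat \<Rightarrow> complex) \<Rightarrow> (nat \<Rightarrow> complex) \<Rightarrow> (nat \<Rightarrow> complex) \<Rightarrow> real" where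
  "sqrt_lasso lam m n A b z =
    lam * l1_norm n z + l2_norm m (\<lambda>i. (\<Sum>j<n. A i j * z j) - b i)"

definition min_norm_lasso ::
  "real \<Rightarrow> nat \<Rightarrow> nat \<Rightarrow> (nat \<Rightarrow> nat \<Rightarrow> complex) \<Rightarrow> (nat \<Rightarrow> complex) \<Rightarrow> (nat \<Rightarrow> complex)" where
  "min_norm_lasso lam m n A b =
    (THE z. is_arg_min (l2_norm n) (is_arg_min (sqrt_lasso lam m n A b) (\<lambda>w. w \<in> cvec n)) z)"

text \<open>The \<open>k\<close> largest entries are not unique if there are ties, so this is the set of the results
  of hard thresholding for all ways of breaking ties.\<close>

definition hard_thresholdings :: "nat \<Rightarrow> nat \<Rightarrow> (nat \<Rightarrow> complex) \<Rightarrow> (nat \<Rightarrow> complex) set" where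
  "hard_thresholdings n k z =
    {(\<lambda>i. if i \<in> S then z i else 0) | S.
      S \<subseteq> {..<n} \<and> card S = min k n \<and> (\<forall>i\<in>S. \<forall>j\<in>{..<n} - S. cmod (z j) \<le> cmod (z i))}"

text \<open>The possible values of \<open>\<R>\<^sub>s\<^sub>,\<^sub>n(f)\<close> for the sampling points \<open>x\<^sub>0, \<dots>, x\<^sub>m\<^sub>-\<^sub>1\<close>; there is exactly
  one, up to ties in the hard thresholding.\<close>

definition sparse_recovery ::
  "(nat \<Rightarrow> 'a \<Rightarrow> complex) \<Rightarrow> real \<Rightarrow> nat \<Rightarrow> nat \<Rightarrow> nat \<Rightarrow> (nat \<Rightarrow> 'a) \<Rightarrow> ('a \<Rightarrow> complex)
    \<Rightarrow> ('a \<Rightarrow> complex) set" where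
  "sparse_recovery \<phi> a s n m x f =
    (let b = (\<lambda>i. f (x i) / complex_of_real (sqrt (real m)));
         A = (\<lambda>i j. \<phi> j (x i) / complex_of_real (sqrt (real m)));
         c = min_norm_lasso (3 / 14 * sqrt (a / real s)) m n A b
     in lincomb \<phi> {..<n} ` hard_thresholdings n (2 * s) c)"

lemma hard_thresholdings_nonempty: "hard_thresholdings n k z \<noteq> {}"
proof -
  have "\<exists>S. S \<subseteq> {..<n} \<and> card S = l \<and> (\<forall>i\<in>S. \<forall>j\<in>{..<n} - S. cmod (z j) \<le> cmod (z i))"
    if "l \<le> n" for l
    using that
  proof (induction l)
    case 0
    show ?case by (rule exI[of _ "{}"]) simp
  next
    case (Suc l)
    then obtain S where S: "S \<subseteq> {..<n}" "card S = l"
      "\<And>i j. i \<in> S \<Longrightarrow> j \<in> {..<n} - S \<Longrightarrow> cmod (z j) \<le> cmod (z i)"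
      by (meson Suc_leD)
    have fin: "finite S" using S(1) finite_subset by blast
    have "S \<noteq> {..<n}" using S(2) Suc.prems by (metis Suc_n_not_le_n card_lessThan)
    then have ne: "{..<n} - S \<noteq> {}" using S(1) by blast
    define k where "k = arg_min_on (\<lambda>i. - cmod (z i)) ({..<n} - S)"
    have k: "k \<in> {..<n} - S"
      unfolding k_def by (rule arg_min_if_finite(1)) (use ne in simp_all)
    have max: "cmod (z j) \<le> cmod (z k)" if "j \<in> {..<n} - S" for j
      using arg_min_least[OF _ ne that, of "\<lambda>i. - cmod (z i)"]
      unfolding k_def by simp
    have "insert k S \<subseteq> {..<n}" using S(1) k by blast
    moreover have "card (insert k S) = Suc l" using fin k S(2) by simp
    moreover have "\<forall>i\<in>insert k S. \<forall>j\<in>{..<n} - insert k S. cmod (z j) \<le> cmod (z i)"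
      using S(3) max by blast
    ultimately show ?case by blast
  qed
  from this[of "min k n"] show ?thesis
    unfolding hard_thresholdings_def by fastforce
qed

end

theory Submission
  imports Defs
begin

text \<open>Let \<open>A\<close> be the normalized matrix of samples and \<open>v\<close> the error of the LASSO minimizer. If \<open>A\<close> has the
robust null space property, i.e. the \<open>\<ell>\<^sup>2\<close>-mass of every vector on \<open>s\<close> coordinates is controlled by its
\<open>\<ell>\<^sup>1\<close>-mass elsewhere and by \<open>A v\<close>, then comparing the LASSO functional at the minimizer and at the true
coefficients bounds \<open>v\<close> in \<open>\<ell>\<^sup>1\<close> and in \<open>\<ell>\<^sup>2\<close>, and hard thresholding spoils this only by a constant
(\<open>sparse_vector_recovery\<close>). The upper Riesz bound turns the \<open>\<ell>\<^sup>2\<close>-estimate into an \<open>L\<^sup>2\<close>-estimate, the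
bound \<open>K\<close> turns the \<open>\<ell>\<^sup>1\<close>-estimate into an \<open>L\<^sup>\<infinity>\<close>-estimate, and the \<open>L\<^sup>p\<close>-norms in between are
interpolated (\<open>recovery_error_Lp\<close>). Chance enters only through the null space property.

The null space property is violated only by vectors with \<open>\<parallel>v\<parallel>\<^sub>1 \<le> 3 \<surd>s \<parallel>v\<parallel>\<^sub>2\<close>. Hence it suffices that with
high probability all functions \<open>f = \<Sum> v\<^sub>j \<phi>\<^sub>j\<close> with such coefficients satisfy a one-sided inequality: the mean of
\<open>|f|\<^sup>2\<close> over the sample is at least a fixed fraction of \<open>\<integral> |f|\<^sup>2\<close>. After dividing by \<open>K \<parallel>v\<parallel>\<^sub>1\<close> this concerns the
functions with \<open>\<parallel>v\<parallel>\<^sub>1 \<le> 1\<close>, \<open>|\<phi>\<^sub>j| \<le> 1\<close> and \<open>\<integral> |f|\<^sup>2 \<ge> \<alpha>\<close>, where \<open>1/\<alpha>\<close> is of the order of \<open>K\<^sup>2 s / a\<close>.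

There are infinitely many such \<open>f\<close>, so \<open>|f|\<^sup>2\<close> is cut into its level sets \<open>|f|\<^sup>2 > 2\<^sup>-\<^sup>i\<close> with
\<open>1 \<le> i \<le> I\<close> and \<open>I\<close> of the order of \<open>log (1/\<alpha>)\<close> (\<open>layer_cake_upper\<close>, \<open>layer_cake_lower\<close>), and on each level \<open>f\<close> is
replaced by one of finitely many functions. By the empirical method of Maurey (\<open>atom_average_approximates\<close>), \<open>f\<close>
is within \<open>2\<^sup>-\<^sup>i\<^sup>/\<^sup>2 / 8\<close> of an average of \<open>L\<^sub>i\<close> functions \<open>2 \<i>\<^sup>q \<phi>\<^sub>j\<close>, outside a set that is small
both for the measure and for the sample; \<open>L\<^sub>i\<close> of the order of \<open>2\<^sup>i log (1/\<alpha>)\<close> suffices. There are \<open>(4 n)\<close> to the power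
\<open>L\<^sub>i\<close> such averages, whatever the sample is, so a union bound over a lower-tail estimate for the
frequency of a fixed event (\<open>empirical_measure_lower_tail\<close>) handles all of them. The price on level \<open>i\<close> is an additive error of the
order of \<open>(L\<^sub>i log n + log (1/\<epsilon>)) / m\<close>. It enters with the weight \<open>2\<^sup>-\<^sup>i\<close>, which cancels the growth of \<open>L\<^sub>i\<close>: every level costs
\<open>log (1/\<alpha>) log n / m\<close>, and the number of levels gives the second logarithm. Their sum is below a
fixed fraction of \<open>\<alpha>\<close> when \<open>m\<close> is as large as assumed.\<close>

section \<open>Existence and uniqueness of the recovered vector\<close>

text \<open>By Tychonoff's theorem, minimization over \<open>\<complex>\<^sup>n\<close> can take place inside the function space \<open>nat \<Rightarrow> complex\<close>
  with its product topology.\<close>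

lemma compact_coordinate_box:
  "compact {z \<in> cvec n. \<forall>i<n. cmod (z i) \<le> R}"
proof -
  have "compactin (product_topology (\<lambda>i. euclidean) UNIV)
      (PiE UNIV (\<lambda>i. if i < n then cball 0 R else {0 :: complex}))"
    by (subst compactin_PiE) auto
  moreover have "PiE UNIV (\<lambda>i. if i < n then cball 0 R else {0 :: complex}) =
      {z \<in> cvec n. \<forall>i<n. cmod (z i) \<le> R}"
    unfolding cvec_def PiE_UNIV_domain Pi_def set_eq_iff mem_Collect_eq by (auto simp: not_less)
  ultimately show ?thesis
    by (metis euclidean_product_topology compactin_euclidean_iff)
qed

lemma continuous_on_l2_norm: "continuous_on A (l2_norm n)"
  unfolding l2_norm_def L2_set_def
  by (intro continuous_intros continuous_on_subset[OF continuous_on_product_coordinates]) auto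

lemma continuous_on_sqrt_lasso: "continuous_on A (sqrt_lasso lam m n M b)"
  unfolding sqrt_lasso_def l1_norm_def l2_norm_def L2_set_def
  by (intro continuous_intros continuous_on_subset[OF continuous_on_product_coordinates]) auto

lemma l2_norm_eq_norm_sum: "(l2_norm n z)\<^sup>2 = (\<Sum>i<n. (cmod (z i))\<^sup>2)"
  by (simp add: l2_norm_def L2_set_def sum_nonneg)

lemma l2_norm_triangle: "l2_norm n (\<lambda>i. u i + v i) \<le> l2_norm n u + l2_norm n v"
proof -
  have "l2_norm n (\<lambda>i. u i + v i) \<le> L2_set (\<lambda>i. cmod (u i) + cmod (v i)) {..<n}"
    unfolding l2_norm_def by (intro L2_set_mono norm_triangle_ineq) auto
  also have "\<dots> \<le> l2_norm n u + l2_norm n v"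
    unfolding l2_norm_def by (rule L2_set_triangle_ineq)
  finally show ?thesis .
qed

lemma l2_norm_scale: "l2_norm n (\<lambda>i. k * u i) = cmod k * l2_norm n u"
  by (simp add: l2_norm_def norm_mult L2_set_right_distrib)

lemma l1_norm_triangle: "l1_norm n (\<lambda>i. u i + v i) \<le> l1_norm n u + l1_norm n v"
  unfolding l1_norm_def sum.distrib[symmetric] by (intro sum_mono norm_triangle_ineq)

lemma l1_norm_scale: "l1_norm n (\<lambda>i. k * u i) = cmod k * l1_norm n u"
  by (simp add: l1_norm_def norm_mult sum_distrib_left)

text \<open>Convexity; the midpoint is the only convex combination that the uniqueness argument needs.\<close>

lemma sqrt_lasso_midpoint:
  assumes "0 \<le> lam"
  shows "sqrt_lasso lam m n M b (\<lambda>i. (u i + v i) / 2)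
    \<le> (sqrt_lasso lam m n M b u + sqrt_lasso lam m n M b v) / 2"
proof -
  have 1: "l1_norm n (\<lambda>i. (u i + v i) / 2) \<le> (l1_norm n u + l1_norm n v) / 2"
    using l1_norm_triangle[of n "\<lambda>i. 1/2 * u i" "\<lambda>i. 1/2 * v i"]
    by (simp only: l1_norm_scale) (simp add: add_divide_distrib norm_divide)
  let ?r = "\<lambda>z i. (\<Sum>j<n. M i j * z j) - b i"
  have "?r (\<lambda>i. (u i + v i) / 2) = (\<lambda>i. 1/2 * ?r u i + 1/2 * ?r v i)"
    by (simp add: fun_eq_iff algebra_simps sum.distrib add_divide_distrib sum_divide_distrib)
  then have 2: "l2_norm m (?r (\<lambda>i. (u i + v i) / 2)) \<le> (l2_norm m (?r u) + l2_norm m (?r v)) / 2"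
    using l2_norm_triangle[of m "\<lambda>i. 1/2 * ?r u i" "\<lambda>i. 1/2 * ?r v i"]
    by (simp only: l2_norm_scale) (simp add: add_divide_distrib norm_divide)
  show ?thesis
    using 2 mult_left_mono[OF 1 assms] unfolding sqrt_lasso_def
    by (simp add: algebra_simps add_divide_distrib)
qed

text \<open>Since \<open>lam\<close> is positive, the functional controls every coordinate, so only a compact box has to be searched.\<close>

lemma sqrt_lasso_minimizers:
  fixes M :: "nat \<Rightarrow> nat \<Rightarrow> complex" and b :: "nat \<Rightarrow> complex" and lam :: real and m n :: nat
  assumes lam: "0 < lam"
  defines "F \<equiv> sqrt_lasso lam m n M b"
  shows "compact {z. is_arg_min F (\<lambda>w. w \<in> cvec n) z}" "\<exists>z. is_arg_min F (\<lambda>w. w \<in> cvec n) z"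
proof -
  define R where "R = F (\<lambda>_. 0) / lam"
  define B where "B = {z \<in> cvec n. \<forall>i<n. cmod (z i) \<le> R}"
  have B: "compact B" unfolding B_def by (rule compact_coordinate_box)
  have Bc: "B \<subseteq> cvec n" unfolding B_def by auto
  have F0: "0 \<le> F z" for z
    using lam by (simp add: F_def sqrt_lasso_def l1_norm_def l2_norm_def sum_nonneg)
  have R0: "0 \<le> R" using F0 lam by (simp add: R_def)
  have inB: "z \<in> B" if z: "z \<in> cvec n" and le: "F z \<le> F (\<lambda>_. 0)" for z
  proof -
    have "cmod (z i) \<le> R" if i: "i < n" for i
    proof -
      have "lam * cmod (z i) \<le> lam * l1_norm n z"
        unfolding l1_norm_def using lam i by (intro mult_left_mono member_le_sum) auto
      also have "\<dots> \<le> F z" unfolding F_def sqrt_lasso_def l2_norm_def by simp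
      also have "\<dots> \<le> F (\<lambda>_. 0)" by fact
      finally show ?thesis using lam by (simp add: R_def field_simps)
    qed
    then show ?thesis using z by (auto simp: B_def)
  qed
  have zB: "(\<lambda>_. 0) \<in> B" using R0 by (simp add: B_def cvec_def)
  obtain u where u: "u \<in> B" "\<And>w. w \<in> B \<Longrightarrow> F u \<le> F w"
    using continuous_attains_inf[OF B, of F] continuous_on_sqrt_lasso zB
    unfolding F_def by blast
  have umin: "F u \<le> F w" if "w \<in> cvec n" for w
    using u(2)[OF zB] u(2)[OF inB[OF that]] by (cases "F w \<le> F (\<lambda>_. 0)") auto
  have "{z. is_arg_min F (\<lambda>w. w \<in> cvec n) z} = {z \<in> B. F z \<le> F u}"
  proof (intro set_eqI iffI)
    fix z assume "z \<in> {z. is_arg_min F (\<lambda>w. w \<in> cvec n) z}"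
    then have z: "z \<in> cvec n" "\<And>w. w \<in> cvec n \<Longrightarrow> F z \<le> F w"
      by (auto simp: is_arg_min_def not_less)
    then show "z \<in> {z \<in> B. F z \<le> F u}" using inB[OF z(1)] z(2) zB u(1) Bc by auto
  next
    fix z assume "z \<in> {z \<in> B. F z \<le> F u}"
    then have z: "z \<in> cvec n" "F z \<le> F u" using Bc by auto
    then show "z \<in> {z. is_arg_min F (\<lambda>w. w \<in> cvec n) z}"
      using order_trans[OF z(2) umin] by (auto simp: is_arg_min_def not_less)
  qed
  moreover have "compact {z \<in> B. F z \<le> F u}"
  proof (rule compact_Int_closed[of B "{z. F z \<le> F u}", unfolded Int_def mem_Collect_eq])
    show "closed {z. F z \<le> F u}"
      unfolding F_def by (intro closed_Collect_le continuous_on_sqrt_lasso continuous_on_const)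
  qed (rule B)
  ultimately show "compact {z. is_arg_min F (\<lambda>w. w \<in> cvec n) z}" by simp
  show "\<exists>z. is_arg_min F (\<lambda>w. w \<in> cvec n) z"
    using u umin Bc by (auto simp: is_arg_min_def not_less)
qed

text \<open>The parallelogram identity, which makes the \<open>\<ell>\<^sup>2\<close>-norm strictly convex.\<close>

lemma l2_norm_midpoint:
  "(l2_norm n (\<lambda>i. (u i + v i) / 2))\<^sup>2 + (l2_norm n (\<lambda>i. (u i - v i) / 2))\<^sup>2
    = ((l2_norm n u)\<^sup>2 + (l2_norm n v)\<^sup>2) / 2"
proof -
  have "(cmod ((a + b) / 2))\<^sup>2 + (cmod ((a - b) / 2))\<^sup>2 = ((cmod a)\<^sup>2 + (cmod b)\<^sup>2) / 2" for a b :: complex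
    unfolding norm_divide power_divide cmod_power2 by (simp add: power2_eq_square field_simps)
  then show ?thesis
    unfolding l2_norm_eq_norm_sum sum.distrib[symmetric] by (simp only: sum_divide_distrib)
qed

text \<open>The description operator denotes something: the minimizers form a nonempty compact set closed under midpoints,
  and a strictly convex function has exactly one minimizer on such a set.\<close>

lemma min_norm_lasso_is_minimizer:
  assumes lam: "0 < lam"
  shows "is_arg_min (sqrt_lasso lam m n M b) (\<lambda>w. w \<in> cvec n) (min_norm_lasso lam m n M b)"
proof -
  define F where "F = sqrt_lasso lam m n M b"
  define P where "P = is_arg_min F (\<lambda>w. w \<in> cvec n)"
  have cpt: "compact {z. P z}" and ne: "\<exists>z. P z"
    unfolding P_def F_def using sqrt_lasso_minimizers[OF lam] by auto
  obtain u where u: "P u" "\<And>w. P w \<Longrightarrow> l2_norm n u \<le> l2_norm n w"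
    using continuous_attains_inf[OF cpt, of "l2_norm n"] continuous_on_l2_norm ne by auto
  have argu: "is_arg_min (l2_norm n) P u"
    using u by (auto simp: is_arg_min_def not_less)
  have uniq: "z = u" if z: "is_arg_min (l2_norm n) P z" for z
  proof -
    have Pz: "P z" and le: "l2_norm n z \<le> l2_norm n u"
      using z u by (auto simp: is_arg_min_def not_less)
    have cv: "z \<in> cvec n" "u \<in> cvec n" using Pz u(1) by (auto simp: P_def is_arg_min_def)
    have mid: "(\<lambda>i. (z i + u i) / 2) \<in> cvec n" using cv by (auto simp: cvec_def)
    have Feq: "F z \<le> F w" "F u \<le> F w" if "w \<in> cvec n" for w
      using Pz u(1) that by (auto simp: P_def is_arg_min_def not_less)
    have "F (\<lambda>i. (z i + u i) / 2) \<le> (F z + F u) / 2"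
      unfolding F_def using lam by (intro sqrt_lasso_midpoint) simp
    then have "F (\<lambda>i. (z i + u i) / 2) \<le> F w" if "w \<in> cvec n" for w
      using Feq[OF that] by simp
    then have "P (\<lambda>i. (z i + u i) / 2)"
      using mid unfolding P_def is_arg_min_def by (auto simp: not_less)
    then have "l2_norm n u \<le> l2_norm n (\<lambda>i. (z i + u i) / 2)" by (rule u(2))
    then have "(l2_norm n u)\<^sup>2 \<le> (l2_norm n (\<lambda>i. (z i + u i) / 2))\<^sup>2"
      by (intro power_mono) (auto simp: l2_norm_def)
    moreover have "(l2_norm n z)\<^sup>2 \<le> (l2_norm n u)\<^sup>2"
      using le by (intro power_mono) (auto simp: l2_norm_def)
    moreover have "d \<le> 0" if "s \<le> p" "t \<le> s" "p + d = (t + s) / 2" for d s t p :: real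
      using that by argo
    ultimately have "(l2_norm n (\<lambda>i. (z i - u i) / 2))\<^sup>2 \<le> 0"
      using l2_norm_midpoint[of n z u] by blast
    then have "\<forall>i<n. z i = u i"
      by (simp add: l2_norm_def L2_set_eq_0_iff)
    then show ?thesis using cv unfolding cvec_def fun_eq_iff
      by (metis (mono_tags, lifting) mem_Collect_eq not_less)
  qed
  have "min_norm_lasso lam m n M b = u"
    unfolding min_norm_lasso_def F_def[symmetric] P_def[symmetric]
    using argu uniq by (rule the_equality)
  then show ?thesis using u(1) by (simp add: P_def F_def)
qed

section \<open>Recovery from the robust null space property\<close>

lemma sum_le_sum_of_card_le:
  fixes u :: "'i \<Rightarrow> real"
  assumes "finite A" "finite B" "card A \<le> card B"
    and le: "\<And>i j. i \<in> A \<Longrightarrow> j \<in> B \<Longrightarrow> u i \<le> u j" and nonneg: "\<And>j. j \<in> B \<Longrightarrow> 0 \<le> u j"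
  shows "sum u A \<le> sum u B"
proof -
  obtain h where h: "h ` A \<subseteq> B" "inj_on h A"
    using card_le_inj[OF assms(1-3)] by blast
  have "sum u A \<le> (\<Sum>i\<in>A. u (h i))" using h le by (intro sum_mono) auto
  also have "\<dots> = sum u (h ` A)" using h(2) by (simp add: sum.reindex)
  also have "\<dots> \<le> sum u B" using h nonneg assms(2) by (intro sum_mono2) auto
  finally show ?thesis .
qed

text \<open>Every entry on \<open>B\<close> is at most the average of \<open>s\<close> entries on \<open>A\<close>; one factor of each square is estimated by
  that average. This is how an \<open>\<ell>\<^sup>1\<close>-bound yields an \<open>\<ell>\<^sup>2\<close>-bound, gaining \<open>\<surd>s\<close>, away from the largest entries.\<close>

lemma L2_set_le_of_dominated:
  fixes u :: "'i \<Rightarrow> real"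
  assumes "finite A" and s: "0 < s" "s \<le> card A"
    and dom: "\<And>i j. i \<in> A \<Longrightarrow> j \<in> B \<Longrightarrow> u j \<le> u i" and nonneg: "\<And>i. 0 \<le> u i"
  shows "L2_set u B \<le> sqrt (sum u A * sum u B / real s)"
proof -
  have le: "real s * u j \<le> sum u A" if "j \<in> B" for j
  proof -
    have "real s * u j \<le> real (card A) * u j" using s nonneg by (intro mult_right_mono) auto
    also have "\<dots> \<le> sum u A" using sum_bounded_below[of A "u j" u] dom that by simp
    finally show ?thesis .
  qed
  have "(\<Sum>j\<in>B. (u j)\<^sup>2) \<le> (\<Sum>j\<in>B. sum u A / real s * u j)"
  proof (rule sum_mono)
    fix j assume "j \<in> B"
    then have "u j \<le> sum u A / real s" using le[of j] s by (simp add: field_simps)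
    then show "(u j)\<^sup>2 \<le> sum u A / real s * u j"
      unfolding power2_eq_square using nonneg by (rule mult_right_mono)
  qed
  also have "\<dots> = sum u A * sum u B / real s" by (simp only: sum_distrib_left[symmetric]) simp
  finally show ?thesis unfolding L2_set_def by (rule real_sqrt_le_mono)
qed

lemma sum_le_sqrt_card_L2_set:
  fixes u :: "'i \<Rightarrow> real"
  assumes "card S \<le> s" "\<And>i. 0 \<le> u i"
  shows "sum u S \<le> sqrt (real s) * L2_set u S"
proof -
  have "sum u S = (\<Sum>i\<in>S. \<bar>u i\<bar> * \<bar>1\<bar>)" using assms by simp
  also have "\<dots> \<le> L2_set u S * L2_set (\<lambda>_. 1) S" by (rule L2_set_mult_ineq)
  also have "\<dots> \<le> L2_set u S * sqrt (real s)"
    using assms by (intro mult_left_mono) (auto simp: L2_set_constant)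
  finally show ?thesis by (simp add: mult.commute)
qed

lemma L2_set_Un_le:
  fixes u :: "'i \<Rightarrow> real"
  assumes "finite A" "finite B" "A \<inter> B = {}"
  shows "L2_set u (A \<union> B) \<le> L2_set u A + L2_set u B"
  unfolding L2_set_def sum.union_disjoint[OF assms]
  by (intro sqrt_add_le_add_sqrt sum_nonneg) auto

text \<open>For a given support the best approximation agrees with \<open>c\<close> there, and there are only finitely many supports, so
  the infimum defining \<open>sigma1\<close> is attained. Working with a support avoids carrying an approximating vector along.\<close>

lemma best_support_exists:
  "\<exists>S\<subseteq>{..<n}. card S \<le> s \<and> (\<Sum>i\<in>{..<n} - S. cmod (c i)) \<le> sigma1 n s c"
proof -
  define \<S> where "\<S> = {S. S \<subseteq> {..<n} \<and> card S \<le> s}"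
  define h where "h = (\<lambda>S. \<Sum>i\<in>{..<n} - S. cmod (c i))"
  have fin: "finite \<S>" unfolding \<S>_def by (rule finite_subset[of _ "Pow {..<n}"]) auto
  have ne: "\<S> \<noteq> {}" unfolding \<S>_def by (auto intro!: exI[of _ "{}"])
  define S where "S = arg_min_on h \<S>"
  have S: "S \<in> \<S>" unfolding S_def using arg_min_if_finite(1)[OF fin ne] .
  have "h S \<le> sigma1 n s c" unfolding sigma1_def
  proof (rule cINF_greatest)
    have "(\<lambda>_. 0) \<in> {z. sparse n s z}" by (simp add: sparse_def cvec_def)
    then show "{z. sparse n s z} \<noteq> {}" by blast
    fix z assume "z \<in> {z. sparse n s z}"
    then have z: "z \<in> cvec n" "card {i. z i \<noteq> 0} \<le> s" by (auto simp: sparse_def)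
    have "{i. z i \<noteq> 0} \<in> \<S>" using z by (auto simp: \<S>_def cvec_def not_less[symmetric])
    then have "h S \<le> h {i. z i \<noteq> 0}"
      unfolding S_def by (intro arg_min_least fin ne)
    also have "\<dots> = (\<Sum>i\<in>{..<n} - {i. z i \<noteq> 0}. cmod (c i - z i))"
      unfolding h_def by (rule sum.cong) auto
    also have "\<dots> \<le> l1_norm n (\<lambda>i. c i - z i)"
      unfolding l1_norm_def by (intro sum_mono2) auto
    finally show "h S \<le> l1_norm n (\<lambda>i. c i - z i)" .
  qed
  then show ?thesis using S by (auto simp: \<S>_def h_def)
qed

lemma largest_entries_exist:
  "\<exists>S\<subseteq>{..<n}. card S = min k n \<and> (\<forall>i\<in>S. \<forall>j\<in>{..<n} - S. cmod (z j) \<le> cmod (z i))"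
  using hard_thresholdings_nonempty[of n k z] unfolding hard_thresholdings_def by blast

text \<open>The recovery argument works for \<open>\<kappa> < 1\<close> and, with the prescribed LASSO parameter, for \<open>\<tau> < 14 / (3 \<surd>a)\<close>; it is carried
  out for \<open>\<kappa> = 1/2\<close> and \<open>\<tau> = 4 / \<surd>a\<close>.\<close>

definition robust_null_space_property ::
  "nat \<Rightarrow> nat \<Rightarrow> nat \<Rightarrow> real \<Rightarrow> real \<Rightarrow> (nat \<Rightarrow> nat \<Rightarrow> complex) \<Rightarrow> bool" where
  "robust_null_space_property m n s \<kappa> \<tau> A \<longleftrightarrow>
    (\<forall>v S. S \<subseteq> {..<n} \<and> card S \<le> s \<longrightarrow>
      L2_set (\<lambda>i. cmod (v i)) S \<le> \<kappa> / sqrt (real s) * (\<Sum>i\<in>{..<n} - S. cmod (v i))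
        + \<tau> * l2_norm m (\<lambda>i. \<Sum>j<n. A i j * v j))"

lemma l1_norm_split:
  assumes "S \<subseteq> {..<n}"
  shows "l1_norm n v = (\<Sum>i\<in>S. cmod (v i)) + (\<Sum>i\<in>{..<n} - S. cmod (v i))"
  unfolding l1_norm_def using sum.subset_diff[OF assms, of "\<lambda>i. cmod (v i)"] by simp

text \<open>Put \<open>v = z - c\<close> and let \<open>T\<close> be the complement of \<open>S\<close>. Minimality of \<open>z\<close> gives
  \<open>\<lambda> \<parallel>v\<^sub>T\<parallel>\<^sub>1 + \<parallel>A v\<parallel>\<^sub>2 \<le> \<lambda> \<parallel>v\<^sub>S\<parallel>\<^sub>1 + 2 \<lambda> \<sigma> + 2 e\<close>. The null space property bounds the first summand on the right by
  \<open>\<lambda>/2 \<parallel>v\<^sub>T\<parallel>\<^sub>1 + 4 \<lambda> \<surd>(s/a) \<parallel>A v\<parallel>\<^sub>2\<close>; for the prescribed \<open>\<lambda>\<close> the last coefficient is \<open>6/7 < 1\<close>, so that both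
  terms can be absorbed on the left. The \<open>\<ell>\<^sup>2\<close>-bound results from a second application of the null space property, to
  the \<open>s\<close> largest entries of \<open>v\<close>.\<close>

lemma sqrt_lasso_error:
  fixes a e :: real and c z :: "nat \<Rightarrow> complex"
  assumes a: "0 < a" and s: "0 < s"
    and nsp: "robust_null_space_property m n s (1/2) (4 / sqrt a) A"
    and z: "is_arg_min (sqrt_lasso (3 / 14 * sqrt (a / real s)) m n A b) (\<lambda>w. w \<in> cvec n) z"
    and e: "l2_norm m (\<lambda>i. (\<Sum>j<n. A i j * c j) - b i) \<le> e"
    and S: "S \<subseteq> {..<n}" "card S \<le> s"
  defines "X \<equiv> (\<Sum>i\<in>{..<n} - S. cmod (c i)) / sqrt (real s) + e / sqrt a"
  shows "l1_norm n (\<lambda>i. z i - c i) \<le> 85 * sqrt (real s) * X"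
    and "l2_norm n (\<lambda>i. z i - c i) \<le> 184 * X"
proof -
  define v where "v = (\<lambda>i. z i - c i)"
  define d where "d = l2_norm m (\<lambda>i. \<Sum>j<n. A i j * v j)"
  define q where "q = sqrt (real s)"
  define r where "r = sqrt a"
  define lam where "lam = 3 / 14 * (r / q)"
  define T where "T = {..<n} - S"
  define \<sigma> where "\<sigma> = (\<Sum>i\<in>T. cmod (c i))"
  define N where "N = (\<lambda>U. \<Sum>i\<in>U. cmod (v i))"
  define D where "D = (\<lambda>U. L2_set (\<lambda>i. cmod (v i)) U)"
  have q: "0 < q" and r: "0 < r" using s a by (auto simp: q_def r_def)
  then have lam: "0 < lam" by (simp add: lam_def)
  have d0: "0 \<le> d" and e0: "0 \<le> e" and N0: "0 \<le> N U" and D0: "0 \<le> D U" and \<sigma>0: "0 \<le> \<sigma>" for U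
    using e by (auto simp: d_def l2_norm_def N_def D_def \<sigma>_def sum_nonneg intro: order_trans[rotated])
  have lam_eq: "3 / 14 * sqrt (a / real s) = lam"
    by (simp add: lam_def q_def r_def real_sqrt_divide)
  have X: "X = \<sigma> / q + e / r" by (simp add: X_def \<sigma>_def q_def r_def T_def)
  have X0: "0 \<le> X" unfolding X using \<sigma>0 e0 q r by simp
  have nspv: "D U \<le> 1/2 / q * N ({..<n} - U) + 4 / r * d" if "U \<subseteq> {..<n}" "card U \<le> s" for U
    using nsp that unfolding robust_null_space_property_def D_def N_def d_def q_def r_def by blast
  let ?res = "\<lambda>w i. (\<Sum>j<n. A i j * w j) - b i"
  define rz where "rz = l2_norm m (?res z)"
  have h1: "lam * l1_norm n z + rz \<le> lam * l1_norm n c + e"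
  proof -
    define w where "w = (\<lambda>i. if i < n then c i else 0)"
    have w: "w \<in> cvec n" by (simp add: w_def cvec_def)
    have "sqrt_lasso lam m n A b z \<le> sqrt_lasso lam m n A b w"
      using z w unfolding lam_eq by (auto simp: is_arg_min_def not_less)
    also have "sqrt_lasso lam m n A b w = sqrt_lasso lam m n A b c"
      by (simp add: sqrt_lasso_def w_def l1_norm_def)
    also have "\<dots> \<le> lam * l1_norm n c + e" using e by (simp add: sqrt_lasso_def)
    finally show ?thesis by (simp add: sqrt_lasso_def rz_def)
  qed
  have h2: "d \<le> rz + e"
  proof -
    have "(\<lambda>i. \<Sum>j<n. A i j * v j) = (\<lambda>i. ?res z i + (-1) * ?res c i)"
      by (simp add: v_def fun_eq_iff algebra_simps sum_subtractf)
    then have "d \<le> l2_norm m (?res z) + l2_norm m (\<lambda>i. (-1) * ?res c i)"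
      unfolding d_def by (simp only: l2_norm_triangle)
    also have "l2_norm m (\<lambda>i. (-1) * ?res c i) = l2_norm m (?res c)"
      unfolding l2_norm_scale by simp
    finally show ?thesis using e by (simp add: rz_def)
  qed
  have h3: "l1_norm n c \<le> l1_norm n z + N S - N T + 2 * \<sigma>"
  proof -
    have "(\<Sum>i\<in>S. cmod (c i)) \<le> (\<Sum>i\<in>S. cmod (z i) + cmod (v i))"
      unfolding v_def by (intro sum_mono) (metis norm_minus_commute norm_triangle_sub)
    moreover have "N T \<le> (\<Sum>i\<in>T. cmod (z i) + cmod (c i))"
      unfolding N_def v_def by (intro sum_mono) (rule norm_triangle_ineq4)
    ultimately show ?thesis
      unfolding l1_norm_split[OF S(1)] \<sigma>_def N_def T_def by (simp add: sum.distrib)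
  qed
  have h4: "N S \<le> q * D S"
    unfolding N_def D_def q_def using S(2) by (intro sum_le_sqrt_card_L2_set) auto
  have h5: "D S \<le> 1/2 / q * N T + 4 / r * d" unfolding T_def using nspv S by blast
  have NS: "lam * N S \<le> lam / 2 * N T + 6 / 7 * d"
  proof -
    have "lam * N S \<le> lam * (q * (1/2 / q * N T + 4 / r * d))"
      using h4 h5 lam q by (intro mult_left_mono order_trans[OF h4]) auto
    also have "\<dots> = lam / 2 * N T + 6 / 7 * d" using q r by (simp add: lam_def field_simps)
    finally show ?thesis .
  qed
  have main: "lam / 2 * N T + d / 7 \<le> 2 * lam * \<sigma> + 2 * e"
  proof -
    have "lam * l1_norm n c \<le> lam * l1_norm n z + lam * N S - lam * N T + 2 * (lam * \<sigma>)"
      using mult_left_mono[OF h3, of lam] lam by (simp add: algebra_simps)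
    then show ?thesis using h1 h2 NS by (simp add: algebra_simps)
  qed
  have NT: "N T \<le> 19 * (q * X)"
  proof -
    have "lam / 2 * N T \<le> 2 * lam * \<sigma> + 2 * e" using main d0 by simp
    then have "N T \<le> 4 * \<sigma> + 4 * e / lam" using lam by (simp add: field_simps)
    also have "\<dots> = 4 * \<sigma> + 56 / 3 * (q * e / r)" using q r by (simp add: lam_def field_simps)
    also have "\<dots> \<le> 19 * \<sigma> + 19 * (q * e / r)"
      using \<sigma>0 e0 q r by (intro add_mono mult_right_mono) auto
    also have "\<dots> = 19 * (q * X)" using q by (simp add: X field_simps)
    finally show ?thesis .
  qed
  have dX: "d \<le> 14 * (r * X)"
  proof -
    have "0 \<le> lam / 2 * N T" using N0[of T] lam by simp
    then have "d / 7 \<le> 2 * lam * \<sigma> + 2 * e" using main by argo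
    then have "d \<le> 3 * (r * \<sigma> / q) + 14 * e" by (simp add: lam_def mult.commute)
    also have "\<dots> \<le> 14 * (r * \<sigma> / q) + 14 * e"
      using \<sigma>0 e0 q r by (intro add_mono mult_right_mono) auto
    also have "\<dots> = 14 * (r * X)" using r by (simp add: X field_simps)
    finally show ?thesis .
  qed
  have d4: "4 / r * d \<le> 56 * X"
    using mult_left_mono[OF dX, of "4 / r"] r by simp
  have DS: "D S \<le> 66 * X"
  proof -
    have "1/2 / q * N T \<le> 1/2 / q * (19 * (q * X))" using NT q by (intro mult_left_mono) auto
    then have "1/2 / q * N T \<le> 10 * X" using q X0 by simp
    then show ?thesis using h5 d4 by linarith
  qed
  have l1v: "l1_norm n v \<le> 85 * (q * X)"
  proof -
    have "N S \<le> q * (66 * X)" using h4 DS q by (meson mult_left_mono less_imp_le order_trans)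
    then have "N S + N T \<le> 85 * (q * X)" using NT by simp
    then show ?thesis using l1_norm_split[OF S(1), of v] by (simp add: N_def T_def)
  qed
  then show "l1_norm n (\<lambda>i. z i - c i) \<le> 85 * sqrt (real s) * X"
    by (simp add: v_def q_def)
  obtain U where U: "U \<subseteq> {..<n}" "card U = min s n"
    "\<And>i j. i \<in> U \<Longrightarrow> j \<in> {..<n} - U \<Longrightarrow> cmod (v j) \<le> cmod (v i)"
    using largest_entries_exist[of n s v] by blast
  have finU: "finite U" using U(1) finite_subset by blast
  have l1v_eq: "l1_norm n v = N U + N ({..<n} - U)"
    unfolding N_def by (rule l1_norm_split[OF U(1)])
  have DU: "D U \<le> 99 * X"
  proof -
    have "1/2 / q * N ({..<n} - U) \<le> 1/2 / q * (85 * (q * X))"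
      using l1v l1v_eq N0[of U] q by (intro mult_left_mono) auto
    also have "\<dots> \<le> 43 * X" using q X0 by simp
    finally show ?thesis using nspv[OF U(1)] U(2) d4 by simp
  qed
  have DU': "D ({..<n} - U) \<le> 85 * X"
  proof (cases "s \<le> n")
    case True
    have "D ({..<n} - U) \<le> sqrt (N U * N ({..<n} - U) / real s)"
      unfolding D_def N_def using finU s True U by (intro L2_set_le_of_dominated) auto
    also have "\<dots> \<le> sqrt ((85 * X)\<^sup>2)"
    proof (rule real_sqrt_le_mono)
      have "N U * N ({..<n} - U) \<le> (85 * (q * X)) * (85 * (q * X))"
        using l1v l1v_eq N0[of U] N0[of "{..<n} - U"] by (intro mult_mono) linarith+
      also have "\<dots> = real s * (85 * X)\<^sup>2" using s by (simp add: q_def power2_eq_square field_simps)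
      finally show "N U * N ({..<n} - U) / real s \<le> (85 * X)\<^sup>2" using s by (simp add: field_simps)
    qed
    also have "sqrt ((85 * X)\<^sup>2) = 85 * X" using X0 by (intro real_sqrt_unique) auto
    finally show ?thesis .
  next
    case False
    then have "U = {..<n}" using U(1,2) by (intro card_subset_eq) auto
    then show ?thesis using X0 by (simp add: D_def)
  qed
  have "l2_norm n v = D (U \<union> ({..<n} - U))" using U(1) by (simp add: D_def l2_norm_def Un_absorb1)
  also have "\<dots> \<le> D U + D ({..<n} - U)" unfolding D_def using finU by (intro L2_set_Un_le) auto
  also have "\<dots> \<le> 184 * X" using DU DU' by simp
  finally show "l2_norm n (\<lambda>i. z i - c i) \<le> 184 * X" by (simp add: v_def)
qed

text \<open>The discarded entries are dominated by the kept ones. Of the \<open>2 s\<close> kept positions at least \<open>s\<close> lie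
  outside \<open>S\<close> (unless nothing is discarded), and these have total mass at most \<open>\<eta>\<close>: this is why the threshold is \<open>2 s\<close> and not \<open>s\<close>.\<close>

lemma hard_thresholding_error:
  fixes z c :: "nat \<Rightarrow> complex"
  assumes s: "0 < s" and g: "g \<in> hard_thresholdings n (2 * s) z"
    and S: "S \<subseteq> {..<n}" "card S \<le> s"
  defines "\<eta> \<equiv> (\<Sum>i\<in>{..<n} - S. cmod (z i))"
  shows "l1_norm n (\<lambda>i. z i - g i) \<le> \<eta>" and "l2_norm n (\<lambda>i. z i - g i) \<le> \<eta> / sqrt (real s)"
proof -
  obtain U where gU: "g = (\<lambda>i. if i \<in> U then z i else 0)"
    and U: "U \<subseteq> {..<n}" "card U = min (2 * s) n"
      "\<And>i j. i \<in> U \<Longrightarrow> j \<in> {..<n} - U \<Longrightarrow> cmod (z j) \<le> cmod (z i)"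
    using g unfolding hard_thresholdings_def by blast
  have fin: "finite U" "finite S" using U(1) S(1) finite_subset by blast+
  have \<eta>0: "0 \<le> \<eta>" by (simp add: \<eta>_def sum_nonneg)
  have cSn: "card S \<le> n" using S(1) card_mono[of "{..<n}" S] by simp
  define W where "W = {..<n} - U"
  have W: "(\<Sum>i\<in>W. cmod (z i)) \<le> \<eta>"
  proof -
    have "card (S - U) \<le> card (U - S)"
    proof -
      have "card S = card (S - U) + card (S \<inter> U)" "card U = card (U - S) + card (S \<inter> U)"
        using fin by (metis card_Diff_subset_Int Int_lower1 Int_commute card_mono finite_Int le_add_diff_inverse2)+
      then show ?thesis using U(2) cSn S(2) by linarith
    qed
    then have "(\<Sum>i\<in>S - U. cmod (z i)) \<le> (\<Sum>i\<in>U - S. cmod (z i))"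
      using fin U(3) S(1) by (intro sum_le_sum_of_card_le) auto
    moreover have "W = (S - U) \<union> ({..<n} - (S \<union> U))" "{..<n} - S = (U - S) \<union> ({..<n} - (S \<union> U))"
      using S(1) U(1) by (auto simp: W_def)
    moreover have "(\<Sum>i\<in>(S - U) \<union> ({..<n} - (S \<union> U)). cmod (z i))
        = (\<Sum>i\<in>S - U. cmod (z i)) + (\<Sum>i\<in>{..<n} - (S \<union> U). cmod (z i))"
      using fin by (intro sum.union_disjoint) auto
    moreover have "(\<Sum>i\<in>(U - S) \<union> ({..<n} - (S \<union> U)). cmod (z i))
        = (\<Sum>i\<in>U - S. cmod (z i)) + (\<Sum>i\<in>{..<n} - (S \<union> U). cmod (z i))"
      using fin by (intro sum.union_disjoint) auto
    ultimately show ?thesis unfolding \<eta>_def by simp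
  qed
  have eq1: "l1_norm n (\<lambda>i. z i - g i) = (\<Sum>i\<in>W. cmod (z i))"
    unfolding l1_norm_def W_def gU by (rule sum.mono_neutral_cong_right) auto
  show "l1_norm n (\<lambda>i. z i - g i) \<le> \<eta>" using eq1 W by simp
  have eq2: "l2_norm n (\<lambda>i. z i - g i) = L2_set (\<lambda>i. cmod (z i)) W"
    unfolding l2_norm_def L2_set_def W_def gU
    by (rule arg_cong[where f = sqrt], rule sum.mono_neutral_cong_right) auto
  show "l2_norm n (\<lambda>i. z i - g i) \<le> \<eta> / sqrt (real s)"
  proof (cases "2 * s \<le> n")
    case True
    have "s \<le> card (U - S)"
      using diff_card_le_card_Diff[of S U] fin U(2) True S(2) by simp
    then have "L2_set (\<lambda>i. cmod (z i)) W
        \<le> sqrt ((\<Sum>i\<in>U - S. cmod (z i)) * (\<Sum>i\<in>W. cmod (z i)) / real s)"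
      using fin s U(3) by (intro L2_set_le_of_dominated) (auto simp: W_def)
    also have "\<dots> \<le> sqrt (\<eta> * \<eta> / real s)"
    proof -
      have "(\<Sum>i\<in>U - S. cmod (z i)) \<le> \<eta>"
        unfolding \<eta>_def using U(1) by (intro sum_mono2) auto
      then show ?thesis using W \<eta>0
        by (intro real_sqrt_le_mono divide_right_mono mult_mono) (auto intro: sum_nonneg)
    qed
    finally show ?thesis using eq2 \<eta>0 by (simp add: real_sqrt_divide)
  next
    case False
    then have "U = {..<n}" using U(1,2) by (intro card_subset_eq) auto
    then show ?thesis using eq2 \<eta>0 by (simp add: W_def)
  qed
qed

lemma sparse_vector_recovery:
  fixes a e :: real and c z :: "nat \<Rightarrow> complex"
  assumes a: "0 < a" and s: "0 < s"
    and nsp: "robust_null_space_property m n s (1/2) (4 / sqrt a) A"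
    and e: "l2_norm m (\<lambda>i. (\<Sum>j<n. A i j * c j) - b i) \<le> e"
    and g: "g \<in> hard_thresholdings n (2 * s) (min_norm_lasso (3 / 14 * sqrt (a / real s)) m n A b)"
  defines "X \<equiv> sigma1 n s c / sqrt (real s) + e / sqrt a"
  shows "l1_norm n (\<lambda>i. c i - g i) \<le> 171 * sqrt (real s) * X"
    and "l2_norm n (\<lambda>i. c i - g i) \<le> 270 * X"
proof -
  define z where "z = min_norm_lasso (3 / 14 * sqrt (a / real s)) m n A b"
  have z: "is_arg_min (sqrt_lasso (3 / 14 * sqrt (a / real s)) m n A b) (\<lambda>w. w \<in> cvec n) z"
    unfolding z_def using a s by (intro min_norm_lasso_is_minimizer) auto
  obtain S where S: "S \<subseteq> {..<n}" "card S \<le> s"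
    and S\<sigma>: "(\<Sum>i\<in>{..<n} - S. cmod (c i)) \<le> sigma1 n s c"
    using best_support_exists[of n s c] by blast
  define Y where "Y = (\<Sum>i\<in>{..<n} - S. cmod (c i)) / sqrt (real s) + e / sqrt a"
  have YX: "Y \<le> X" unfolding Y_def X_def using S\<sigma> s a by (intro add_mono divide_right_mono) auto
  have q: "0 < sqrt (real s)" using s by simp
  have e0: "0 \<le> e" using order_trans[OF _ e] by (simp add: l2_norm_def)
  have l1: "l1_norm n (\<lambda>i. z i - c i) \<le> 85 * sqrt (real s) * X"
    using sqrt_lasso_error(1)[OF a s nsp z e S] YX q unfolding Y_def[symmetric]
    by (meson mult_left_mono order_trans mult_nonneg_nonneg less_imp_le zero_le_numeral)
  have l2: "l2_norm n (\<lambda>i. z i - c i) \<le> 184 * X"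
    using sqrt_lasso_error(2)[OF a s nsp z e S] YX unfolding Y_def[symmetric] by linarith
  define \<eta> where "\<eta> = (\<Sum>i\<in>{..<n} - S. cmod (z i))"
  have \<eta>: "\<eta> \<le> 86 * sqrt (real s) * X"
  proof -
    have "\<eta> \<le> (\<Sum>i\<in>{..<n} - S. cmod (c i) + cmod (z i - c i))"
      unfolding \<eta>_def by (intro sum_mono) (metis norm_triangle_sub)
    also have "\<dots> \<le> sigma1 n s c + l1_norm n (\<lambda>i. z i - c i)"
      unfolding sum.distrib l1_norm_def by (intro add_mono S\<sigma> sum_mono2) auto
    also have "sigma1 n s c \<le> sqrt (real s) * X"
      unfolding X_def using q e0 a by (simp add: field_simps)
    finally show ?thesis using l1 by simp
  qed
  have ht: "l1_norm n (\<lambda>i. z i - g i) \<le> \<eta>" "l2_norm n (\<lambda>i. z i - g i) \<le> \<eta> / sqrt (real s)"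
    using hard_thresholding_error[OF s g S] unfolding \<eta>_def z_def by auto
  have split: "(\<lambda>i. c i - g i) = (\<lambda>i. (-1) * (z i - c i) + (z i - g i))" by (simp add: fun_eq_iff)
  have "l1_norm n (\<lambda>i. c i - g i) \<le> l1_norm n (\<lambda>i. (-1) * (z i - c i)) + l1_norm n (\<lambda>i. z i - g i)"
    unfolding split by (rule l1_norm_triangle)
  also have "l1_norm n (\<lambda>i. (-1) * (z i - c i)) = l1_norm n (\<lambda>i. z i - c i)"
    unfolding l1_norm_scale by simp
  finally show "l1_norm n (\<lambda>i. c i - g i) \<le> 171 * sqrt (real s) * X" using l1 ht(1) \<eta> by simp
  have "l2_norm n (\<lambda>i. c i - g i) \<le> l2_norm n (\<lambda>i. (-1) * (z i - c i)) + l2_norm n (\<lambda>i. z i - g i)"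
    unfolding split by (rule l2_norm_triangle)
  also have "l2_norm n (\<lambda>i. (-1) * (z i - c i)) = l2_norm n (\<lambda>i. z i - c i)"
    unfolding l2_norm_scale by simp
  also have "\<eta> / sqrt (real s) \<le> 86 * X" using \<eta> q by (simp add: field_simps)
  then have "l2_norm n (\<lambda>i. z i - g i) \<le> 86 * X" using ht(2) by linarith
  finally show "l2_norm n (\<lambda>i. c i - g i) \<le> 270 * X" using l2 by linarith
qed

section \<open>Deviations of averages of independent draws\<close>

text \<open>A replacement for Hoeffding's lemma: for a centred variable the linear term disappears after averaging.\<close>

lemma exp_le_self_plus_exp_square: "exp y \<le> y + exp (y\<^sup>2)" for y :: real
proof -
  have sq: "1 + y\<^sup>2 \<le> exp (y\<^sup>2)" by (rule exp_ge_add_one_self)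
  consider "y < -1" | "-1 \<le> y" "y < 0" | "0 \<le> y" "y \<le> 1" | "1 < y" by linarith
  then show ?thesis
  proof cases
    case 1
    have "exp y \<le> 1" using 1 by simp
    moreover have "0 \<le> y * (y + 1)" using 1 by (intro mult_nonpos_nonpos) auto
    then have "0 \<le> y + y\<^sup>2" by (simp add: power2_eq_square algebra_simps)
    ultimately show ?thesis using sq by linarith
  next
    case 2
    have "exp y * (1 - y) \<le> exp y * exp (- y)"
      using exp_ge_add_one_self[of "- y"] by (intro mult_left_mono) auto
    then have "exp y * (1 - y) \<le> 1" by (simp add: exp_minus_inverse)
    also have "1 \<le> (1 + y + y\<^sup>2) * (1 - y)"
    proof -
      have "y ^ 3 \<le> 0" using 2 by (simp add: power_le_zero_eq)
      then show ?thesis by (simp add: algebra_simps power2_eq_square power3_eq_cube)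
    qed
    finally have "exp y \<le> 1 + y + y\<^sup>2" using 2 by (simp add: mult_le_cancel_right)
    then show ?thesis using sq by linarith
  next
    case 3
    then have "exp y \<le> 1 + y + y\<^sup>2" by (rule exp_bound)
    then show ?thesis using sq by linarith
  next
    case 4
    then have "y \<le> y\<^sup>2" by (simp add: power2_eq_square)
    then have "exp y \<le> exp (y\<^sup>2)" by (simp only: exp_le_cancel_iff)
    then show ?thesis using 4 by linarith
  qed
qed

text \<open>Hoeffding's inequality for \<open>L\<close> independent draws from the finitely supported distribution \<open>w\<close>, by exponential
  moments. A tuple \<open>\<zeta>\<close> of draws carries the product of its weights, so the probability is a finite sum.\<close>

lemma weighted_average_tail_real:
  fixes w X :: "'z \<Rightarrow> real"
  assumes Z: "finite Z" and w: "\<And>z. z \<in> Z \<Longrightarrow> 0 \<le> w z" "sum w Z = 1"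
    and mean: "(\<Sum>z\<in>Z. w z * X z) = 0" and X: "\<And>z. z \<in> Z \<Longrightarrow> \<bar>X z\<bar> \<le> c"
    and c: "0 < c" and u: "0 < u"
  shows "(\<Sum>\<zeta>\<in>PiE {..<L} (\<lambda>_. Z). (\<Prod>k<L. w (\<zeta> k)) * of_bool (real L * u < (\<Sum>k<L. X (\<zeta> k))))
    \<le> exp (- (real L * u\<^sup>2 / (4 * c\<^sup>2)))"
proof -
  define \<theta> where "\<theta> = u / (2 * c\<^sup>2)"
  have \<theta>: "0 < \<theta>" using c u by (simp add: \<theta>_def)
  have W0: "0 \<le> (\<Prod>k<L. w (\<zeta> k))" if "\<zeta> \<in> PiE {..<L} (\<lambda>_. Z)" for \<zeta>
    using that w(1) by (intro prod_nonneg) auto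
  have mgf: "(\<Sum>z\<in>Z. w z * exp (\<theta> * X z)) \<le> exp (\<theta>\<^sup>2 * c\<^sup>2)"
  proof -
    have "(\<Sum>z\<in>Z. w z * exp (\<theta> * X z)) \<le> (\<Sum>z\<in>Z. w z * (\<theta> * X z + exp (\<theta>\<^sup>2 * c\<^sup>2)))"
    proof (intro sum_mono mult_left_mono w)
      fix z assume z: "z \<in> Z"
      have "(X z)\<^sup>2 \<le> c\<^sup>2" using X[OF z] c by (intro iffD1[OF abs_le_square_iff]) simp
      then have "exp ((\<theta> * X z)\<^sup>2) \<le> exp (\<theta>\<^sup>2 * c\<^sup>2)" by (simp add: power_mult_distrib mult_left_mono)
      then show "exp (\<theta> * X z) \<le> \<theta> * X z + exp (\<theta>\<^sup>2 * c\<^sup>2)"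
        using exp_le_self_plus_exp_square[of "\<theta> * X z"] by linarith
    qed
    also have "\<dots> = \<theta> * (\<Sum>z\<in>Z. w z * X z) + sum w Z * exp (\<theta>\<^sup>2 * c\<^sup>2)"
      by (simp add: algebra_simps sum.distrib sum_distrib_left sum_distrib_right)
    finally show ?thesis using mean w by simp
  qed
  have "(\<Sum>\<zeta>\<in>PiE {..<L} (\<lambda>_. Z). (\<Prod>k<L. w (\<zeta> k)) * of_bool (real L * u < (\<Sum>k<L. X (\<zeta> k))))
      \<le> (\<Sum>\<zeta>\<in>PiE {..<L} (\<lambda>_. Z). (\<Prod>k<L. w (\<zeta> k)) *
          (exp (- (\<theta> * (real L * u))) * (\<Prod>k<L. exp (\<theta> * X (\<zeta> k)))))"
  proof (intro sum_mono mult_left_mono W0)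
    fix \<zeta>
    have "exp (- (\<theta> * (real L * u))) * (\<Prod>k<L. exp (\<theta> * X (\<zeta> k)))
        = exp (\<theta> * ((\<Sum>k<L. X (\<zeta> k)) - real L * u))"
      by (simp add: exp_sum[symmetric] exp_add[symmetric] sum_distrib_left[symmetric] algebra_simps)
    also have "of_bool (real L * u < (\<Sum>k<L. X (\<zeta> k))) \<le> \<dots>"
      using \<theta> by (auto simp: of_bool_def)
    finally show "of_bool (real L * u < (\<Sum>k<L. X (\<zeta> k)))
      \<le> exp (- (\<theta> * (real L * u))) * (\<Prod>k<L. exp (\<theta> * X (\<zeta> k)))" .
  qed
  also have "\<dots> = exp (- (\<theta> * (real L * u))) *
      (\<Sum>\<zeta>\<in>PiE {..<L} (\<lambda>_. Z). \<Prod>k<L. w (\<zeta> k) * exp (\<theta> * X (\<zeta> k)))"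
    by (simp add: sum_distrib_left prod.distrib mult_ac)
  also have "(\<Sum>\<zeta>\<in>PiE {..<L} (\<lambda>_. Z). \<Prod>k<L. w (\<zeta> k) * exp (\<theta> * X (\<zeta> k)))
      = (\<Sum>z\<in>Z. w z * exp (\<theta> * X z)) ^ L"
    using Z by (subst prod_sum_PiE[symmetric]) auto
  also have "exp (- (\<theta> * (real L * u))) * \<dots> \<le> exp (- (\<theta> * (real L * u))) * exp (\<theta>\<^sup>2 * c\<^sup>2) ^ L"
    using mgf w by (intro mult_left_mono power_mono sum_nonneg) auto
  also have "\<dots> = exp (- (real L * u\<^sup>2 / (4 * c\<^sup>2)))"
    using c by (simp add: \<theta>_def exp_of_nat_mult[symmetric] exp_add[symmetric] power2_eq_square field_simps)
  finally show ?thesis .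
qed

lemma sum_product_weights:
  fixes w :: "'z \<Rightarrow> real" and L :: nat
  assumes "finite Z" "sum w Z = 1"
  shows "(\<Sum>\<zeta>\<in>PiE {..<L} (\<lambda>_. Z). \<Prod>k<L. w (\<zeta> k)) = 1"
  using prod_sum_PiE[of "{..<L}" "\<lambda>_. Z" "\<lambda>_. w"] assms by simp

lemma Re_of_nat_mult: "Re (of_nat L * y) = real L * Re y"
  by simp

text \<open>Reduces the deviation of a complex number to that of four real ones.\<close>

lemma cmod_gt_imp_quarter_turn:
  assumes "u < cmod x"
  shows "\<exists>q<4. u / 2 < Re (\<i> ^ q * x)"
proof -
  have "cmod x \<le> \<bar>Re x\<bar> + \<bar>Im x\<bar>" by (rule cmod_le)
  then have "u / 2 < Re x \<or> u / 2 < - Re x \<or> u / 2 < Im x \<or> u / 2 < - Im x"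
    using assms by linarith
  moreover have "Re (\<i> ^ 0 * x) = Re x" "Re (\<i> ^ 1 * x) = - Im x" "Re (\<i> ^ 2 * x) = - Re x"
    "Re (\<i> ^ 3 * x) = Im x"
    by (simp_all add: power3_eq_cube)
  ultimately show ?thesis
    by (metis numeral_less_iff one_less_numeral_iff semiring_norm(76,78,79,80,81) zero_less_numeral)
qed

text \<open>The centred values are bounded by \<open>2 c\<close> and the threshold is halved by the passage to a real part, which turns the
  factor \<open>4\<close> of the real inequality into \<open>64\<close>.\<close>

lemma weighted_average_tail:
  fixes w :: "'z \<Rightarrow> real" and x :: "'z \<Rightarrow> complex"
  assumes Z: "finite Z" and w: "\<And>z. z \<in> Z \<Longrightarrow> 0 \<le> w z" "sum w Z = 1"
    and x: "\<And>z. z \<in> Z \<Longrightarrow> cmod (x z) \<le> c" and mean: "(\<Sum>z\<in>Z. w z * x z) = f"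
    and c: "0 < c" and u: "0 < u" and L: "0 < L"
  shows "(\<Sum>\<zeta>\<in>PiE {..<L} (\<lambda>_. Z). (\<Prod>k<L. w (\<zeta> k)) *
      of_bool (u < cmod ((\<Sum>k<L. x (\<zeta> k)) / L - f)))
    \<le> 4 * exp (- (real L * u\<^sup>2 / (64 * c\<^sup>2)))"
proof -
  define X where "X = (\<lambda>q z. Re (\<i> ^ q * (x z - f)))"
  have W0: "0 \<le> (\<Prod>k<L. w (\<zeta> k))" if "\<zeta> \<in> PiE {..<L} (\<lambda>_. Z)" for \<zeta>
    using that w(1) by (intro prod_nonneg) auto
  have f: "cmod f \<le> c"
  proof -
    have "cmod f \<le> (\<Sum>z\<in>Z. w z * c)"
      unfolding mean[symmetric] using w x by (intro sum_norm_le) (auto simp: norm_mult mult_left_mono)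
    then show ?thesis using w by (simp add: sum_distrib_right[symmetric])
  qed
  have tail: "(\<Sum>\<zeta>\<in>PiE {..<L} (\<lambda>_. Z). (\<Prod>k<L. w (\<zeta> k)) *
      of_bool (real L * (u / 2) < (\<Sum>k<L. X q (\<zeta> k)))) \<le> exp (- (real L * (u/2)\<^sup>2 / (4 * (2 * c)\<^sup>2)))" for q
  proof (rule weighted_average_tail_real[OF Z w])
    have "(\<Sum>z\<in>Z. w z * X q z) = Re (\<i> ^ q * (\<Sum>z\<in>Z. w z * (x z - f)))"
      unfolding X_def Re_sum sum_distrib_left by (intro sum.cong) (auto simp: algebra_simps)
    also have "(\<Sum>z\<in>Z. w z * (x z - f)) = (\<Sum>z\<in>Z. w z * x z) - of_real (sum w Z) * f"
      by (simp add: algebra_simps sum_subtractf sum_distrib_left sum_distrib_right)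
    finally show "(\<Sum>z\<in>Z. w z * X q z) = 0" using mean w(2) by simp
    fix z assume z: "z \<in> Z"
    have "\<bar>X q z\<bar> \<le> cmod (\<i> ^ q * (x z - f))" unfolding X_def by (rule abs_Re_le_cmod)
    also have "\<dots> \<le> cmod (x z) + cmod f" by (simp add: norm_mult norm_power norm_triangle_ineq4)
    also have "\<dots> \<le> 2 * c" using x[OF z] f by simp
    finally show "\<bar>X q z\<bar> \<le> 2 * c" .
  qed (use c u in auto)
  have "(\<Sum>\<zeta>\<in>PiE {..<L} (\<lambda>_. Z). (\<Prod>k<L. w (\<zeta> k)) *
      of_bool (u < cmod ((\<Sum>k<L. x (\<zeta> k)) / L - f)))
    \<le> (\<Sum>\<zeta>\<in>PiE {..<L} (\<lambda>_. Z). (\<Prod>k<L. w (\<zeta> k)) *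
      (\<Sum>q<4::nat. of_bool (real L * (u / 2) < (\<Sum>k<L. X q (\<zeta> k)))))"
  proof (intro sum_mono mult_left_mono W0)
    fix \<zeta>
    show "of_bool (u < cmod ((\<Sum>k<L. x (\<zeta> k)) / L - f))
      \<le> (\<Sum>q<4::nat. of_bool (real L * (u / 2) < (\<Sum>k<L. X q (\<zeta> k))) :: real)"
    proof (cases "u < cmod ((\<Sum>k<L. x (\<zeta> k)) / L - f)")
      case True
      then obtain q :: nat where q: "q < 4" "u / 2 < Re (\<i> ^ q * ((\<Sum>k<L. x (\<zeta> k)) / L - f))"
        using cmod_gt_imp_quarter_turn by blast
      have "real L * (u / 2) < real L * Re (\<i> ^ q * ((\<Sum>k<L. x (\<zeta> k)) / L - f))"
        using q L by (intro mult_strict_left_mono) auto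
      also have "\<dots> = Re (of_nat L * (\<i> ^ q * ((\<Sum>k<L. x (\<zeta> k)) / L - f)))"
        by (simp only: Re_of_nat_mult)
      also have "of_nat L * (\<i> ^ q * ((\<Sum>k<L. x (\<zeta> k)) / L - f))
          = \<i> ^ q * (of_nat L * ((\<Sum>k<L. x (\<zeta> k)) / L - f))"
        by (rule mult.left_commute)
      also have "of_nat L * ((\<Sum>k<L. x (\<zeta> k)) / L - f) = (\<Sum>k<L. x (\<zeta> k) - f)"
        using L by (simp add: sum_subtractf right_diff_distrib)
      also have "Re (\<i> ^ q * (\<Sum>k<L. x (\<zeta> k) - f)) = (\<Sum>k<L. X q (\<zeta> k))"
        by (simp add: X_def sum_distrib_left)
      finally have "(1::real) \<le> of_bool (real L * (u / 2) < (\<Sum>k<L. X q (\<zeta> k)))" by simp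
      also have "\<dots> \<le> (\<Sum>q<4. of_bool (real L * (u / 2) < (\<Sum>k<L. X q (\<zeta> k))))"
        using q by (intro member_le_sum) auto
      finally show ?thesis using True by simp
    qed (simp add: sum_nonneg)
  qed
  also have "\<dots> = (\<Sum>q<4::nat. \<Sum>\<zeta>\<in>PiE {..<L} (\<lambda>_. Z). (\<Prod>k<L. w (\<zeta> k)) *
      of_bool (real L * (u / 2) < (\<Sum>k<L. X q (\<zeta> k))))"
    unfolding sum_distrib_left by (rule sum.swap)
  also have "\<dots> \<le> (\<Sum>q<4::nat. exp (- (real L * (u/2)\<^sup>2 / (4 * (2 * c)\<^sup>2))))"
    by (intro sum_mono tail)
  also have "\<dots> = 4 * exp (- (real L * u\<^sup>2 / (64 * c\<^sup>2)))"
    by (simp add: power_divide power_mult_distrib)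
  finally show ?thesis .
qed

section \<open>Approximation by averages of few atoms\<close>

text \<open>The positive and negative parts of the real and imaginary parts of \<open>v j\<close> serve as weights of the four atoms
  at \<open>j\<close>. The factor \<open>2\<close> compensates \<open>|Re z| + |Im z| \<le> 2 |z|\<close>. The mass left over is spread evenly, which changes
  nothing since the four powers of \<open>\<i>\<close> add up to zero.\<close>

lemma l1_ball_in_convex_hull_of_atoms:
  fixes v :: "nat \<Rightarrow> complex"
  assumes n: "0 < n" and v: "(\<Sum>j<n. cmod (v j)) \<le> 1"
  shows "\<exists>w :: nat \<times> nat \<Rightarrow> real. (\<forall>z. (0 :: real) \<le> w z) \<and> sum w ({..<n} \<times> {..<4}) = (1 :: real) \<and>
    (\<forall>y. (\<Sum>z\<in>{..<n} \<times> {..<4}. w z * (2 * \<i> ^ snd z * y (fst z))) = (\<Sum>j<n. v j * y j))"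
proof -
  define p where "p = (\<lambda>j q. if q = 0 then max (Re (v j)) 0 / 2 else if q = 1 then max (Im (v j)) 0 / 2
    else if q = (2::nat) then max (- Re (v j)) 0 / 2 else max (- Im (v j)) 0 / 2)"
  \<comment> \<open>the unused mass, shared equally by all \<open>4 n\<close> atoms\<close>
  define r where "r = (1 - (\<Sum>j<n. \<Sum>q<4. p j q)) / (4 * real n)"
  have four: "{..<4} = {0, 1, 2, 3 :: nat}" by auto
  have psum: "(\<Sum>q<4. p j q) \<le> cmod (v j)" for j
    unfolding four using abs_Re_le_cmod[of "v j"] abs_Im_le_cmod[of "v j"] by (simp add: p_def)
  then have "(\<Sum>j<n. \<Sum>q<4. p j q) \<le> 1" using v sum_mono[of "{..<n}"] by (meson order_trans)
  then have r0: "0 \<le> r" by (simp add: r_def)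
  define w where "w = (\<lambda>z. p (fst z) (snd z) + r)"
  have w0: "0 \<le> w z" for z using r0 by (auto simp: w_def p_def)
  have "sum w ({..<n} \<times> {..<4}) = (\<Sum>j<n. \<Sum>q<4. p j q) + 4 * real n * r"
    unfolding w_def sum.distrib by (simp add: sum.cartesian_product case_prod_unfold)
  also have "\<dots> = 1" using n by (simp add: r_def)
  finally have w1: "sum w ({..<n} \<times> {..<4}) = 1" .
  have "(\<Sum>z\<in>{..<n} \<times> {..<4}. w z * (2 * \<i> ^ snd z * y (fst z))) = (\<Sum>j<n. v j * y j)" for y
  proof -
    have "(\<Sum>z\<in>{..<n} \<times> {..<4}. w z * (2 * \<i> ^ snd z * y (fst z)))
        = (\<Sum>j<n. (\<Sum>q<4. of_real (p j q + r) * (2 * \<i> ^ q)) * y j)"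
      unfolding w_def sum_distrib_right sum.cartesian_product
      by (intro sum.cong) (auto simp: mult_ac)
    also have "\<dots> = (\<Sum>j<n. v j * y j)"
    proof (rule sum.cong[OF refl])
      fix j
      have "(\<Sum>q<4. of_real (p j q + r) * (2 * \<i> ^ q)) = v j"
        unfolding four by (simp add: p_def complex_eq_iff power3_eq_cube max_def)
      then show "(\<Sum>q<4. of_real (p j q + r) * (2 * \<i> ^ q)) * y j = v j * y j" by simp
    qed
    finally show ?thesis .
  qed
  then show ?thesis using w0 w1 by blast
qed

text \<open>An average of \<open>L\<close> atoms, where the pair \<open>(j, q)\<close> stands for the function \<open>2 \<i>\<^sup>q \<psi>\<^sub>j\<close>.\<close>

definition atom_average :: "(nat \<Rightarrow> 'a \<Rightarrow> complex) \<Rightarrow> nat \<Rightarrow> (nat \<Rightarrow> nat \<times> nat) \<Rightarrow> 'a \<Rightarrow> complex" where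
  "atom_average \<psi> L \<zeta> t = (\<Sum>k<L. 2 * \<i> ^ snd (\<zeta> k) * \<psi> (fst (\<zeta> k)) t) / of_nat L"

lemma atom_average_measurable[measurable]:
  assumes "\<And>j. \<psi> j \<in> borel_measurable M"
  shows "atom_average \<psi> L \<zeta> \<in> borel_measurable M"
  unfolding atom_average_def using assms by measurable

abbreviation atoms :: "nat \<Rightarrow> (nat \<times> nat) set" where
  "atoms n \<equiv> {..<n} \<times> {..<4}"

text \<open>Maurey's empirical method. The function is the mean of its atoms, so at every single point an average of random
  atoms is far off only with small probability. Integrating this over \<open>M\<close> and averaging it over the
  sample shows that the expected total size of both exceptional sets is at most \<open>\<delta>\<close>; hence some tuple
  \<open>\<zeta>\<close> makes both small at once. The tuple depends on \<open>v\<close> and \<open>x\<close>, but it comes from a finite set that does not.\<close>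

lemma (in prob_space) atom_average_approximates:
  fixes v :: "nat \<Rightarrow> complex" and x :: "nat \<Rightarrow> 'a"
  assumes meas[measurable]: "\<And>j. \<psi> j \<in> borel_measurable M"
    and bdd: "AE t in M. \<forall>j<n. cmod (\<psi> j t) \<le> 1"
    and bddx: "\<And>k j. k < m \<Longrightarrow> j < n \<Longrightarrow> cmod (\<psi> j (x k)) \<le> 1"
    and n: "0 < n" and m: "0 < m" and v: "(\<Sum>j<n. cmod (v j)) \<le> 1"
    and u: "0 < u" and L: "0 < L" and \<delta>: "8 * exp (- (real L * u\<^sup>2 / 256)) \<le> \<delta>"
  defines "far \<equiv> \<lambda>\<zeta> t. u < cmod (atom_average \<psi> L \<zeta> t - lincomb \<psi> {..<n} v t)"
  shows "\<exists>\<zeta>\<in>PiE {..<L} (\<lambda>_. atoms n). prob {t \<in> space M. far \<zeta> t} \<le> \<delta> \<and>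
    (\<Sum>k<m. of_bool (far \<zeta> (x k))) / m \<le> \<delta>"
proof -
  obtain w :: "nat \<times> nat \<Rightarrow> real" where w: "\<And>z. 0 \<le> w z" "sum w (atoms n) = 1"
    and rep: "\<And>y. (\<Sum>z\<in>atoms n. w z * (2 * \<i> ^ snd z * y (fst z))) = (\<Sum>j<n. v j * y j)"
    using l1_ball_in_convex_hull_of_atoms[OF n v] by blast
  define \<Z> where "\<Z> = PiE {..<L} (\<lambda>_. atoms n)"
  define W where "W = (\<lambda>\<zeta> :: nat \<Rightarrow> nat \<times> nat. \<Prod>k<L. w (\<zeta> k))"
  have W0: "0 \<le> W \<zeta>" for \<zeta> unfolding W_def using w by (intro prod_nonneg) auto
  have W1: "sum W \<Z> = 1" unfolding W_def \<Z>_def using w by (intro sum_product_weights) auto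
  have fin: "finite \<Z>" unfolding \<Z>_def by (intro finite_PiE) auto
  define p where "p = 4 * exp (- (real L * u\<^sup>2 / 256))"
  have pt: "(\<Sum>\<zeta>\<in>\<Z>. W \<zeta> * of_bool (far \<zeta> t)) \<le> p" if t: "\<forall>j<n. cmod (\<psi> j t) \<le> 1" for t
  proof -
    have "(\<Sum>\<zeta>\<in>\<Z>. W \<zeta> * of_bool (u < cmod ((\<Sum>k<L. 2 * \<i> ^ snd (\<zeta> k) * \<psi> (fst (\<zeta> k)) t) / L - lincomb \<psi> {..<n} v t)))
      \<le> 4 * exp (- (real L * u\<^sup>2 / (64 * 2\<^sup>2)))"
      unfolding W_def \<Z>_def
      by (rule weighted_average_tail)
        (use w u L t rep[of "\<lambda>j. \<psi> j t"] in \<open>auto simp: norm_mult norm_power lincomb_def\<close>)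
    then show ?thesis by (simp add: far_def atom_average_def p_def)
  qed
  have far_meas[measurable]: "{t \<in> space M. far \<zeta> t} \<in> sets M" for \<zeta>
    unfolding far_def lincomb_def by measurable
  have A: "(\<Sum>\<zeta>\<in>\<Z>. W \<zeta> * prob {t \<in> space M. far \<zeta> t}) \<le> p"
  proof -
    have "(\<Sum>\<zeta>\<in>\<Z>. W \<zeta> * prob {t \<in> space M. far \<zeta> t})
        = (\<integral>t. (\<Sum>\<zeta>\<in>\<Z>. W \<zeta> * indicator {t \<in> space M. far \<zeta> t} t) \<partial>M)"
      by (subst Bochner_Integration.integral_sum) (auto simp: emeasure_eq_measure)
    also have "\<dots> \<le> (\<integral>t. p \<partial>M)"
    proof (rule integral_mono_AE)
      show "AE t in M. (\<Sum>\<zeta>\<in>\<Z>. W \<zeta> * indicator {t \<in> space M. far \<zeta> t} t) \<le> p"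
        using bdd
      proof eventually_elim
        case (elim t)
        have "(\<Sum>\<zeta>\<in>\<Z>. W \<zeta> * indicator {t \<in> space M. far \<zeta> t} t) \<le> (\<Sum>\<zeta>\<in>\<Z>. W \<zeta> * of_bool (far \<zeta> t))"
          using W0 by (intro sum_mono mult_left_mono) (auto simp: indicator_def)
        then show ?case using pt[OF elim] by linarith
      qed
    qed (auto simp: emeasure_eq_measure intro!: Bochner_Integration.integrable_sum)
    finally show ?thesis by (simp add: prob_space)
  qed
  have B: "(\<Sum>\<zeta>\<in>\<Z>. W \<zeta> * ((\<Sum>k<m. of_bool (far \<zeta> (x k))) / m)) \<le> p"
  proof -
    have "(\<Sum>\<zeta>\<in>\<Z>. W \<zeta> * ((\<Sum>k<m. of_bool (far \<zeta> (x k))) / m))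
        = (\<Sum>k<m. \<Sum>\<zeta>\<in>\<Z>. W \<zeta> * of_bool (far \<zeta> (x k))) / m"
      by (simp only: times_divide_eq_right sum_divide_distrib[symmetric] sum_distrib_left)
        (subst sum.swap, rule refl)
    also have "\<dots> \<le> (\<Sum>k<m. p) / m"
      using bddx by (intro divide_right_mono sum_mono pt) auto
    finally show ?thesis using m by simp
  qed
  define b where "b = (\<lambda>\<zeta>. prob {t \<in> space M. far \<zeta> t} + (\<Sum>k<m. of_bool (far \<zeta> (x k))) / m)"
  have "\<exists>\<zeta>\<in>\<Z>. b \<zeta> \<le> \<delta>"
  proof (rule ccontr)
    assume "\<not> ?thesis"
    then have big: "\<delta> < b \<zeta>" if "\<zeta> \<in> \<Z>" for \<zeta> using that by force
    have "\<exists>\<zeta>\<in>\<Z>. W \<zeta> \<noteq> 0" using W1 by (metis sum.neutral zero_neq_one)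
    then obtain \<zeta>0 where z0: "\<zeta>0 \<in> \<Z>" "0 < W \<zeta>0" using W0 by (metis less_eq_real_def)
    have "(\<Sum>\<zeta>\<in>\<Z>. W \<zeta> * \<delta>) < (\<Sum>\<zeta>\<in>\<Z>. W \<zeta> * b \<zeta>)"
    proof (rule sum_strict_mono_ex1[OF fin])
      show "\<forall>\<zeta>\<in>\<Z>. W \<zeta> * \<delta> \<le> W \<zeta> * b \<zeta>"
        by (intro ballI mult_left_mono W0 less_imp_le[OF big])
      show "\<exists>\<zeta>\<in>\<Z>. W \<zeta> * \<delta> < W \<zeta> * b \<zeta>"
        using z0 big by (auto intro!: bexI[of _ \<zeta>0])
    qed
    also have "\<dots> \<le> 2 * p" using A B by (simp add: b_def distrib_left sum.distrib)
    also have "\<dots> \<le> \<delta>" using \<delta> by (simp add: p_def)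
    finally show False using W1 by (simp add: sum_distrib_right[symmetric])
  qed
  then obtain \<zeta> where \<zeta>: "\<zeta> \<in> \<Z>" "b \<zeta> \<le> \<delta>" by blast
  have "0 \<le> prob {t \<in> space M. far \<zeta> t}" "0 \<le> (\<Sum>k<m. of_bool (far \<zeta> (x k)) :: real) / m"
    by (auto intro!: divide_nonneg_nonneg sum_nonneg)
  then have "prob {t \<in> space M. far \<zeta> t} \<le> \<delta>" "(\<Sum>k<m. of_bool (far \<zeta> (x k))) / m \<le> \<delta>"
    using \<zeta>(2) unfolding b_def by linarith+
  then show ?thesis using \<zeta>(1) unfolding \<Z>_def by blast
qed

section \<open>Comparison of a mean square with its sampled mean\<close>

lemma sum_half_powers_le_1: "(\<Sum>i=1..I. (1/2) ^ i) \<le> (1 :: real)"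
proof -
  have "(\<Sum>i=1..I. (1/2) ^ i) = 1 - (1/2 :: real) ^ I" by (induction I) auto
  then show ?thesis by simp
qed

text \<open>The levels \<open>2\<^sup>-\<^sup>i\<close> telescope: \<open>2\<^sup>-\<^sup>i = 2\<^sup>-\<^sup>(\<^sup>i\<^sup>-\<^sup>1\<^sup>) - 2\<^sup>-\<^sup>i\<close>, and what lies below the last level is the first summand.\<close>

lemma layer_cake_upper:
  fixes y :: real
  assumes "0 \<le> y" "y \<le> 1"
  shows "y \<le> (1/2) ^ I + (\<Sum>i=1..I. (1/2) ^ i * of_bool ((1/2) ^ i < y))"
proof (induction I)
  case 0
  then show ?case using assms by simp
next
  case (Suc I)
  show ?case
  proof (cases "(1/2) ^ Suc I < y")
    case True
    then show ?thesis using Suc by simp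
  next
    case False
    have "0 \<le> (\<Sum>i=1..Suc I. (1/2) ^ i * of_bool ((1/2) ^ i < y) :: real)" by (intro sum_nonneg) auto
    then show ?thesis using False by linarith
  qed
qed

text \<open>The converse estimate with the levels lowered by a factor \<open>2\<close>; the room between the two is what
  an approximation of the function may use up. The sum is geometric from the first level below \<open>y\<close> on, and the induction keeps its tail
  \<open>(1/2)\<^sup>I\<close> as a reserve.\<close>

lemma layer_cake_lower:
  fixes y :: real
  assumes "0 \<le> y"
  shows "(\<Sum>i=1..I. (1/2) ^ i * of_bool ((1/2) ^ Suc i < y)) \<le> 4 * y"
proof -
  let ?S = "\<lambda>I. (\<Sum>i=1..I. (1/2) ^ i * of_bool ((1/2) ^ Suc i < y)) :: real"
  \<comment> \<open>as long as no level has been passed, the sum is zero; afterwards it stays \<open>(1/2)\<^sup>I\<close> below the bound\<close>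
  have "(?S I = 0 \<and> y \<le> (1/2) ^ Suc I) \<or> ?S I \<le> 4 * y - (1/2) ^ I"
  proof (induction I)
    case 0
    show ?case by auto
  next
    case (Suc I)
    have pos: "(0 :: real) < (1/2) ^ I" by simp
    have half: "(1/2) ^ Suc I = (1/2) ^ I / (2 :: real)" "(1/2) ^ Suc (Suc I) = (1/2) ^ I / (4 :: real)" by simp_all
    have S: "?S (Suc I) = ?S I + (1/2) ^ I / 2 * of_bool ((1/2) ^ I / 4 < y)"
      using half by simp
    define p where "p = (1/2 :: real) ^ I"
    define T where "T = ?S I"
    have T: "T = 0 \<and> y \<le> p / 2 \<or> T \<le> 4 * y - p" using Suc half by (simp add: T_def p_def)
    have "0 < p" using pos by (simp add: p_def)
    then show ?case
      unfolding S half T_def[symmetric] p_def[symmetric] using T by (cases "p / 4 < y") auto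
  qed
  moreover have "(0 :: real) < (1/2) ^ I" by simp
  ultimately show ?thesis using assms by linarith
qed

text \<open>The deterministic part of the sampling argument. On level \<open>i\<close>, with \<open>T = 2\<^sup>-\<^sup>i\<^sup>/\<^sup>2\<close> and an average \<open>g\<close> of atoms within \<open>T/8\<close> of
  \<open>f\<close> up to exceptional sets, \<open>|f| > T\<close> implies \<open>|g| > 7/8 T\<close>, and this in turn implies \<open>|f| > 3/4 T\<close>, so that
  \<open>|f|\<^sup>2 > 2\<^sup>-\<^sup>(\<^sup>i\<^sup>+\<^sup>1\<^sup>)\<close>. The measure and the sample are compared only at the middle step, where the function is \<open>g\<close>. The factor
  \<open>8\<close> is \<open>2\<close> from that comparison times \<open>4\<close> from the lowered levels.\<close>

lemma (in prob_space) sampled_square_mean_lower_bound: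
  fixes v :: "nat \<Rightarrow> complex" and x :: "nat \<Rightarrow> 'a" and I :: nat and L :: "nat \<Rightarrow> nat"
  assumes meas[measurable]: "\<And>j. \<psi> j \<in> borel_measurable M"
    and bdd: "AE t in M. \<forall>j<n. cmod (\<psi> j t) \<le> 1"
    and bddx: "\<And>k j. k < m \<Longrightarrow> j < n \<Longrightarrow> cmod (\<psi> j (x k)) \<le> 1"
    and n: "0 < n" and m: "0 < m" and v: "(\<Sum>j<n. cmod (v j)) \<le> 1"
    and L: "\<And>i. 0 < L i" and \<delta>0: "0 \<le> \<delta>"
    and \<delta>: "\<And>i. i \<in> {1..I} \<Longrightarrow> 8 * exp (- (real (L i) * (1/2) ^ i / 16384)) \<le> \<delta>"
    and good: "\<And>i \<zeta>. i \<in> {1..I} \<Longrightarrow> \<zeta> \<in> PiE {..<L i} (\<lambda>_. atoms n) \<Longrightarrow>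
      prob {t \<in> space M. 7/8 * sqrt ((1/2) ^ i) < cmod (atom_average \<psi> (L i) \<zeta> t)}
      \<le> 2 * (\<Sum>k<m. of_bool (7/8 * sqrt ((1/2) ^ i) < cmod (atom_average \<psi> (L i) \<zeta> (x k)))) / m + \<eta> i"
  defines "f \<equiv> lincomb \<psi> {..<n} v"
  shows "(\<integral>t. (cmod (f t))\<^sup>2 \<partial>M)
    \<le> 8 * ((\<Sum>k<m. (cmod (f (x k)))\<^sup>2) / m) + (1/2) ^ I + 3 * \<delta> + (\<Sum>i=1..I. (1/2) ^ i * \<eta> i)"
proof -
  have f[measurable]: "f \<in> borel_measurable M" unfolding f_def lincomb_def by measurable
  have f1: "AE t in M. (cmod (f t))\<^sup>2 \<le> 1"
    using bdd
  proof eventually_elim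
    case (elim t)
    have "cmod (f t) \<le> (\<Sum>j<n. cmod (v j))"
      unfolding f_def lincomb_def using elim by (intro sum_norm_le) (simp add: norm_mult mult_left_le)
    then have "cmod (f t) \<le> 1" using v by linarith
    then show ?case by (simp add: power_le_one)
  qed
  define F where "F = (\<lambda>i. {t \<in> space M. (1/2) ^ i < (cmod (f t))\<^sup>2})"
  have F[measurable]: "F i \<in> sets M" for i unfolding F_def by measurable
  have intF: "integrable M (\<lambda>t. (1/2) ^ i * indicator (F i) t :: real)" for i
    by (auto simp: emeasure_eq_measure)
  have int_le: "(\<integral>t. (cmod (f t))\<^sup>2 \<partial>M) \<le> (1/2) ^ I + (\<Sum>i=1..I. (1/2) ^ i * prob (F i))"
  proof -
    have "(\<integral>t. (cmod (f t))\<^sup>2 \<partial>M) \<le> (\<integral>t. (1/2) ^ I + (\<Sum>i=1..I. (1/2) ^ i * indicator (F i) t) \<partial>M)"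
    proof (rule integral_mono_AE)
      show "integrable M (\<lambda>t. (cmod (f t))\<^sup>2)"
        using f1 by (intro integrable_const_bound[where B = 1]) auto
      show "integrable M (\<lambda>t. (1/2) ^ I + (\<Sum>i=1..I. (1/2) ^ i * indicator (F i) t) :: real)"
        by (intro Bochner_Integration.integrable_add integrable_const Bochner_Integration.integrable_sum intF)
      show "AE t in M. (cmod (f t))\<^sup>2 \<le> (1/2) ^ I + (\<Sum>i=1..I. (1/2) ^ i * indicator (F i) t)"
        using f1 AE_space
      proof eventually_elim
        case (elim t)
        have "(indicator (F i) t :: real) = of_bool ((1/2) ^ i < (cmod (f t))\<^sup>2)" for i
          using elim by (auto simp: F_def indicator_def)
        then show ?case using layer_cake_upper[of "(cmod (f t))\<^sup>2" I] elim by simp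
      qed
    qed
    also have "\<dots> = (1/2) ^ I + (\<Sum>i=1..I. (1/2) ^ i * prob (F i))"
      by (subst Bochner_Integration.integral_add, simp,
          rule Bochner_Integration.integrable_sum[OF intF],
          subst Bochner_Integration.integral_sum[OF intF])
        (auto simp: prob_space)
    finally show ?thesis .
  qed
  define G where "G = (\<lambda>i. (\<Sum>k<m. of_bool ((1/2) ^ Suc i < (cmod (f (x k)))\<^sup>2)) / real m)"
  have layer: "prob (F i) \<le> 2 * G i + \<eta> i + 3 * \<delta>" if i: "i \<in> {1..I}" for i
  proof -
    define T where "T = sqrt ((1/2 :: real) ^ i)"
    have T0: "0 < T" and T2: "T\<^sup>2 = (1/2) ^ i" by (auto simp: T_def)
    define far where "far = (\<lambda>\<zeta> t. T / 8 < cmod (atom_average \<psi> (L i) \<zeta> t - f t))"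
    define big where "big = (\<lambda>\<zeta> t. 7/8 * T < cmod (atom_average \<psi> (L i) \<zeta> t))"
    have "\<exists>\<zeta>\<in>PiE {..<L i} (\<lambda>_. atoms n). prob {t \<in> space M. far \<zeta> t} \<le> \<delta> \<and>
        (\<Sum>k<m. of_bool (far \<zeta> (x k))) / m \<le> \<delta>"
      unfolding far_def f_def
      by (rule atom_average_approximates)
        (use meas bdd bddx n m v L \<delta>[OF i] T0 T2 in \<open>auto simp: power_divide mult.commute\<close>)
    then obtain \<zeta> where \<zeta>: "\<zeta> \<in> PiE {..<L i} (\<lambda>_. atoms n)" "prob {t \<in> space M. far \<zeta> t} \<le> \<delta>"
      "(\<Sum>k<m. of_bool (far \<zeta> (x k))) / m \<le> \<delta>" by blast
    have s1: "big \<zeta> t \<or> far \<zeta> t" if "(1/2) ^ i < (cmod (f t))\<^sup>2" for t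
    proof -
      have "T < cmod (f t)" using that T2 by (metis norm_ge_zero power2_less_imp_less)
      moreover have "cmod (f t) \<le> cmod (atom_average \<psi> (L i) \<zeta> t) + cmod (atom_average \<psi> (L i) \<zeta> t - f t)"
        by (metis norm_minus_commute norm_triangle_sub)
      ultimately show ?thesis unfolding big_def far_def by linarith
    qed
    have s2: "(1/2) ^ Suc i < (cmod (f t))\<^sup>2 \<or> far \<zeta> t" if "big \<zeta> t" for t
    proof (rule ccontr)
      assume no: "\<not> ?thesis"
      have "cmod (atom_average \<psi> (L i) \<zeta> t) \<le> cmod (f t) + cmod (atom_average \<psi> (L i) \<zeta> t - f t)"
        by (rule norm_triangle_sub)
      then have "3/4 * T < cmod (f t)" using no that unfolding big_def far_def by linarith
      then have "(3/4 * T)\<^sup>2 < (cmod (f t))\<^sup>2" using T0 by (intro power_strict_mono) auto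
      moreover have "(3/4 * T)\<^sup>2 = 9/16 * (1/2) ^ i" unfolding power_mult_distrib T2 by (simp add: power2_eq_square)
      moreover have "(cmod (f t))\<^sup>2 \<le> (1/2) ^ i / 2" using no by auto
      moreover have "(0 :: real) < (1/2) ^ i" by simp
      ultimately show False by linarith
    qed
    have sets[measurable]: "{t \<in> space M. far \<zeta> t} \<in> sets M" "{t \<in> space M. big \<zeta> t} \<in> sets M"
      unfolding far_def big_def by measurable
    have "prob (F i) \<le> prob ({t \<in> space M. big \<zeta> t} \<union> {t \<in> space M. far \<zeta> t})"
      using s1 by (intro finite_measure_mono) (auto simp: F_def)
    also have "\<dots> \<le> prob {t \<in> space M. big \<zeta> t} + prob {t \<in> space M. far \<zeta> t}"
      by (intro measure_Un_le) auto
    also have "\<dots> \<le> 2 * (\<Sum>k<m. of_bool (big \<zeta> (x k))) / m + \<eta> i + \<delta>"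
      using good[OF i \<zeta>(1)] \<zeta>(2) unfolding big_def T_def by linarith
    also have "(\<Sum>k<m. of_bool (big \<zeta> (x k)) :: real)
        \<le> (\<Sum>k<m. of_bool ((1/2) ^ Suc i < (cmod (f (x k)))\<^sup>2) + of_bool (far \<zeta> (x k)))"
      using s2 by (intro sum_mono) (auto simp: of_bool_def)
    also have "2 * \<dots> / m + \<eta> i + \<delta> \<le> 2 * G i + \<eta> i + 3 * \<delta>"
      using \<zeta>(3) unfolding G_def by (simp add: sum.distrib add_divide_distrib)
    finally show ?thesis by (simp add: divide_right_mono)
  qed
  have sumG: "(\<Sum>i=1..I. (1/2) ^ i * G i) \<le> 4 * ((\<Sum>k<m. (cmod (f (x k)))\<^sup>2) / m)"
  proof -
    have "(\<Sum>i=1..I. (1/2) ^ i * G i)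
        = (\<Sum>k<m. \<Sum>i=1..I. (1/2) ^ i * of_bool ((1/2) ^ Suc i < (cmod (f (x k)))\<^sup>2)) / m"
      unfolding G_def
      by (simp only: times_divide_eq_right sum_divide_distrib[symmetric] sum_distrib_left)
        (subst sum.swap, rule refl)
    also have "\<dots> \<le> (\<Sum>k<m. 4 * (cmod (f (x k)))\<^sup>2) / m"
      by (intro divide_right_mono sum_mono layer_cake_lower) auto
    finally show ?thesis by (simp add: sum_distrib_left[symmetric])
  qed
  note geo = sum_half_powers_le_1[of I]
  have "(\<Sum>i=1..I. (1/2) ^ i * prob (F i)) \<le> (\<Sum>i=1..I. (1/2) ^ i * (2 * G i + \<eta> i + 3 * \<delta>))"
    by (intro sum_mono mult_left_mono layer) auto
  also have "\<dots> = 2 * (\<Sum>i=1..I. (1/2) ^ i * G i) + (\<Sum>i=1..I. (1/2) ^ i * \<eta> i)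
      + 3 * \<delta> * (\<Sum>i=1..I. (1/2) ^ i)"
    by (simp add: sum.distrib sum_distrib_left algebra_simps)
  also have "3 * \<delta> * (\<Sum>i=1..I. (1/2) ^ i) \<le> 3 * \<delta>"
    using geo \<delta>0 by (intro mult_left_le) auto
  finally show ?thesis using int_le sumG by linarith
qed

section \<open>A sampling event of high probability\<close>

text \<open>Markov's inequality for \<open>exp (- number of hits)\<close>, whose expectation is at most \<open>exp (- m P(B) / 2)\<close>. Giving
  away a factor \<open>2\<close> in the frequency makes the failure probability depend on the additive error \<open>\<eta>\<close> alone.\<close>

lemma (in prob_space) empirical_measure_lower_tail:
  fixes m :: nat and \<eta> :: real
  assumes B[measurable]: "B \<in> sets M"
  shows "measure (PiM {..<m} (\<lambda>_. M))
    {x \<in> space (PiM {..<m} (\<lambda>_. M)). 2 * (\<Sum>k<m. indicator B (x k)) < real m * (prob B - \<eta>)}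
    \<le> exp (- (real m * \<eta> / 2))"
proof -
  interpret P: product_prob_space "\<lambda>_. M" "{..<m}" ..
  define N where "N = PiM {..<m} (\<lambda>_. M)"
  interpret N: prob_space N unfolding N_def by (rule P.prob_space_axioms)
  define h where "h = (\<lambda>t. exp (- indicator B t) :: real)"
  have h[measurable]: "h \<in> borel_measurable M" unfolding h_def by measurable
  have hint: "integrable M h"
    by (rule integrable_const_bound[where B = 1]) (auto simp: h_def)
  have heq: "h t = 1 - (1 - exp (-1)) * indicator B t" for t
    by (auto simp: h_def indicator_def)
  have "expectation h = 1 - (1 - exp (-1)) * prob B"
    unfolding heq by (subst Bochner_Integration.integral_diff) (auto simp: prob_space emeasure_eq_measure)
  also have "\<dots> \<le> 1 - prob B / 2"
  proof -
    have "2 \<le> exp (1 :: real)" using exp_ge_add_one_self[of 1] by simp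
    then have "exp (-1) \<le> (1/2 :: real)" by (simp add: exp_minus field_simps)
    then have "1/2 * prob B \<le> (1 - exp (-1)) * prob B" by (intro mult_right_mono) auto
    then show ?thesis by simp
  qed
  also have "\<dots> \<le> exp (- (prob B / 2))" using exp_ge_add_one_self[of "- (prob B / 2)"] by simp
  finally have hle: "expectation h \<le> exp (- (prob B / 2))" .
  have h0: "0 \<le> expectation h" by (intro integral_nonneg_AE) (auto simp: h_def)
  define C where "C = exp (real m * (prob B - \<eta>) / 2)"
  define A where "A = {x \<in> space N. 2 * (\<Sum>k<m. indicator B (x k)) < real m * (prob B - \<eta>)}"
  have comp[measurable]: "k < m \<Longrightarrow> (\<lambda>x. x k) \<in> measurable N M" for k
    unfolding N_def by (rule measurable_component_singleton) auto
  have A[measurable]: "A \<in> sets N"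
    unfolding A_def by measurable
  have prodint: "integrable N (\<lambda>x. \<Prod>k<m. h (x k))"
    unfolding N_def using hint by (intro P.product_integrable_prod) auto
  have "measure N A = (\<integral>x. indicator A x \<partial>N)" by simp
  also have "\<dots> \<le> (\<integral>x. C * (\<Prod>k<m. h (x k)) \<partial>N)"
  proof (rule integral_mono_AE)
    show "integrable N (indicator A :: _ \<Rightarrow> real)" by (simp add: N.emeasure_eq_measure)
    show "integrable N (\<lambda>x. C * (\<Prod>k<m. h (x k)))" using prodint by simp
    show "AE x in N. indicator A x \<le> C * (\<Prod>k<m. h (x k))"
    proof (rule AE_I2)
      fix x
      have "C * (\<Prod>k<m. h (x k)) = exp (real m * (prob B - \<eta>) / 2 - (\<Sum>k<m. indicator B (x k)))"
        unfolding C_def h_def exp_sum[OF finite_lessThan, symmetric] exp_add[symmetric]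
        by (simp add: sum_negf)
      also have "indicator A x \<le> \<dots>"
      proof (cases "x \<in> A")
        case True
        then have "0 \<le> real m * (prob B - \<eta>) / 2 - (\<Sum>k<m. indicator B (x k))"
          unfolding A_def by simp
        then show ?thesis using True by simp
      qed simp
      finally show "indicator A x \<le> C * (\<Prod>k<m. h (x k))" .
    qed
  qed
  also have "\<dots> = C * (\<Prod>k<m. expectation h)"
    unfolding N_def using hint by (subst integral_mult_right_zero, subst P.product_integral_prod) auto
  also have "\<dots> \<le> C * exp (- (prob B / 2)) ^ m"
    using hle h0 by (auto simp: C_def intro!: mult_left_mono power_mono)
  also have "\<dots> = exp (- (real m * \<eta> / 2))"
    by (simp add: C_def exp_of_nat_mult[symmetric] exp_add[symmetric] field_simps)
  finally show ?thesis by (simp add: A_def N_def)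
qed

text \<open>Union bound over all levels and all averages of atoms; level \<open>i\<close> has \<open>(4 n)\<close> to the power \<open>L i\<close> of them. The null
  set of samples at which some \<open>\<psi> j\<close> exceeds its essential bound is removed as well.\<close>

lemma (in prob_space) good_sample_event:
  fixes m n I :: nat and L :: "nat \<Rightarrow> nat" and \<eta> :: "nat \<Rightarrow> real"
  assumes meas[measurable]: "\<And>j. \<psi> j \<in> borel_measurable M"
    and bdd: "AE t in M. \<forall>j<n. cmod (\<psi> j t) \<le> 1" and m: "0 < m"
  shows "\<exists>E\<in>sets (PiM {..<m} (\<lambda>_. M)).
    1 - (\<Sum>i=1..I. (4 * real n) ^ L i * exp (- (real m * \<eta> i / 2))) \<le> measure (PiM {..<m} (\<lambda>_. M)) E \<and>
    (\<forall>x\<in>E. (\<forall>k<m. \<forall>j<n. cmod (\<psi> j (x k)) \<le> 1) \<and>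
      (\<forall>i\<in>{1..I}. \<forall>\<zeta>\<in>PiE {..<L i} (\<lambda>_. atoms n).
        prob {t \<in> space M. 7/8 * sqrt ((1/2) ^ i) < cmod (atom_average \<psi> (L i) \<zeta> t)}
        \<le> 2 * (\<Sum>k<m. of_bool (7/8 * sqrt ((1/2) ^ i) < cmod (atom_average \<psi> (L i) \<zeta> (x k)))) / m + \<eta> i))"
proof -
  interpret P: product_prob_space "\<lambda>_. M" "{..<m}" ..
  define N where "N = PiM {..<m} (\<lambda>_. M)"
  interpret N: prob_space N unfolding N_def by (rule P.prob_space_axioms)
  have comp[measurable]: "k < m \<Longrightarrow> (\<lambda>x. x k) \<in> measurable N M" for k
    unfolding N_def by (rule measurable_component_singleton) auto
  define B where "B = (\<lambda>i \<zeta>. {t \<in> space M. 7/8 * sqrt ((1/2) ^ i) < cmod (atom_average \<psi> (L i) \<zeta> t)})"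
  have B[measurable]: "B i \<zeta> \<in> sets M" for i \<zeta> unfolding B_def by measurable
  define bad where "bad = (\<lambda>i \<zeta>. {x \<in> space N. 2 * (\<Sum>k<m. indicator (B i \<zeta>) (x k)) < real m * (prob (B i \<zeta>) - \<eta> i)})"
  have bad[measurable]: "bad i \<zeta> \<in> sets N" for i \<zeta> unfolding bad_def by measurable
  define bad0 where "bad0 = {x \<in> space N. \<not> (\<forall>k<m. \<forall>j<n. cmod (\<psi> j (x k)) \<le> 1)}"
  have bad0[measurable]: "bad0 \<in> sets N" unfolding bad0_def by measurable
  have "AE x in N. \<forall>k\<in>{..<m}. \<forall>j<n. cmod (\<psi> j (x k)) \<le> 1"
    unfolding N_def using bdd
    by (intro AE_finite_allI P.AE_component) auto
  then have "AE x in N. x \<notin> bad0" by eventually_elim (auto simp: bad0_def)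
  then have bad0_null: "measure N bad0 = 0"
    using bad0 by (simp add: AE_iff_measurable[OF bad0] N.prob_eq_0)
  define Z where "Z = (\<lambda>i. PiE {..<L i} (\<lambda>_. atoms n))"
  have Z: "finite (Z i)" "card (Z i) = (4 * n) ^ L i" for i
    unfolding Z_def by (auto simp: card_PiE card_cartesian_product mult.commute intro!: finite_PiE)
  define E where "E = space N - (bad0 \<union> (\<Union>i\<in>{1..I}. \<Union>\<zeta>\<in>Z i. bad i \<zeta>))"
  have U: "(\<Union>i\<in>{1..I}. \<Union>\<zeta>\<in>Z i. bad i \<zeta>) \<in> sets N"
    using Z by (intro sets.finite_UN) auto
  have E: "E \<in> sets N" unfolding E_def using U by auto
  have "measure N (bad0 \<union> (\<Union>i\<in>{1..I}. \<Union>\<zeta>\<in>Z i. bad i \<zeta>))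
      \<le> measure N bad0 + measure N (\<Union>i\<in>{1..I}. \<Union>\<zeta>\<in>Z i. bad i \<zeta>)"
    using U by (intro measure_Un_le) auto
  also have "measure N (\<Union>i\<in>{1..I}. \<Union>\<zeta>\<in>Z i. bad i \<zeta>) \<le> (\<Sum>i\<in>{1..I}. measure N (\<Union>\<zeta>\<in>Z i. bad i \<zeta>))"
    using Z by (intro measure_UNION_le) (auto intro!: sets.finite_UN)
  also have "\<dots> \<le> (\<Sum>i\<in>{1..I}. \<Sum>\<zeta>\<in>Z i. measure N (bad i \<zeta>))"
    using Z by (intro sum_mono measure_UNION_le) auto
  also have "\<dots> \<le> (\<Sum>i\<in>{1..I}. \<Sum>\<zeta>\<in>Z i. exp (- (real m * \<eta> i / 2)))"
    unfolding bad_def N_def by (intro sum_mono empirical_measure_lower_tail) auto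
  also have "\<dots> = (\<Sum>i=1..I. (4 * real n) ^ L i * exp (- (real m * \<eta> i / 2)))" using Z by simp
  finally have "1 - (\<Sum>i=1..I. (4 * real n) ^ L i * exp (- (real m * \<eta> i / 2))) \<le> measure N E"
    unfolding E_def using U bad0_null by (subst N.prob_compl) auto
  moreover have "(\<forall>k<m. \<forall>j<n. cmod (\<psi> j (x k)) \<le> 1) \<and>
      (\<forall>i\<in>{1..I}. \<forall>\<zeta>\<in>PiE {..<L i} (\<lambda>_. atoms n).
        prob {t \<in> space M. 7/8 * sqrt ((1/2) ^ i) < cmod (atom_average \<psi> (L i) \<zeta> t)}
        \<le> 2 * (\<Sum>k<m. of_bool (7/8 * sqrt ((1/2) ^ i) < cmod (atom_average \<psi> (L i) \<zeta> (x k)))) / m + \<eta> i)"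
    if x: "x \<in> E" for x
  proof (intro conjI ballI)
    show "\<forall>k<m. \<forall>j<n. cmod (\<psi> j (x k)) \<le> 1" using x by (auto simp: E_def bad0_def)
    fix i \<zeta> assume i: "i \<in> {1..I}" and \<zeta>: "\<zeta> \<in> PiE {..<L i} (\<lambda>_. atoms n)"
    have xs: "x \<in> space N" using x by (simp add: E_def)
    then have xk: "x k \<in> space M" if "k < m" for k
      using that measurable_space[OF comp] by blast
    have "x \<notin> bad i \<zeta>" using x i \<zeta> by (auto simp: E_def Z_def)
    then have "real m * (prob (B i \<zeta>) - \<eta> i) \<le> 2 * (\<Sum>k<m. indicator (B i \<zeta>) (x k))"
      using xs by (auto simp: bad_def not_less)
    also have "(\<Sum>k<m. indicator (B i \<zeta>) (x k))
        = (\<Sum>k<m. of_bool (7/8 * sqrt ((1/2) ^ i) < cmod (atom_average \<psi> (L i) \<zeta> (x k))) :: real)"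
      using xk by (intro sum.cong) (auto simp: B_def indicator_def)
    finally have "prob (B i \<zeta>)
        \<le> 2 * (\<Sum>k<m. of_bool (7/8 * sqrt ((1/2) ^ i) < cmod (atom_average \<psi> (L i) \<zeta> (x k)))) / m + \<eta> i"
      using m by (simp add: field_simps)
    then show "prob {t \<in> space M. 7/8 * sqrt ((1/2) ^ i) < cmod (atom_average \<psi> (L i) \<zeta> t)}
        \<le> 2 * (\<Sum>k<m. of_bool (7/8 * sqrt ((1/2) ^ i) < cmod (atom_average \<psi> (L i) \<zeta> (x k)))) / m + \<eta> i"
      by (simp add: B_def)
  qed
  ultimately show ?thesis using E unfolding N_def by blast
qed

text \<open>Choice of the parameters. The number \<open>I\<close> of levels makes the part below the last level at most \<open>\<alpha>/8\<close>; \<open>L i\<close> makes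
  the exceptional sets of the approximation at most \<open>\<delta> = \<alpha>/24\<close>; and \<open>\<eta> i\<close> makes the bound for the failure probability of level \<open>i\<close> equal to \<open>\<epsilon> / 2\<^sup>i\<close>. The weighted sum of
  the \<open>\<eta> i\<close> is then at most \<open>\<alpha>/4\<close> by the assumption on \<open>m\<close>. All errors together amount to \<open>\<alpha>/2\<close>, hence to half of the integral.\<close>

lemma (in prob_space) uniform_lower_bound_on_l1_ball:
  fixes m n :: nat and \<alpha> \<epsilon> :: real
  assumes meas: "\<And>j. \<psi> j \<in> borel_measurable M"
    and bdd: "AE t in M. \<forall>j<n. cmod (\<psi> j t) \<le> 1"
    and n: "0 < n" and \<alpha>: "0 < \<alpha>" "\<alpha> \<le> 1" and \<epsilon>: "0 < \<epsilon>" "\<epsilon> < 1"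
    and m: "20000000 * (1 / \<alpha>) * ((ln (2 / \<alpha>))\<^sup>2 * ln (2 * real n) + ln (1 / \<epsilon>)) \<le> real m"
  shows "\<exists>E\<in>sets (PiM {..<m} (\<lambda>_. M)). 1 - \<epsilon> \<le> measure (PiM {..<m} (\<lambda>_. M)) E \<and>
    (\<forall>x\<in>E. \<forall>v. (\<Sum>j<n. cmod (v j)) \<le> 1 \<longrightarrow> \<alpha> \<le> (\<integral>t. (cmod (lincomb \<psi> {..<n} v t))\<^sup>2 \<partial>M) \<longrightarrow>
      (\<integral>t. (cmod (lincomb \<psi> {..<n} v t))\<^sup>2 \<partial>M) / 16 \<le> (\<Sum>k<m. (cmod (lincomb \<psi> {..<n} v (x k)))\<^sup>2) / m)"
proof -
  define l where "l = ln (2 / \<alpha>)"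
  define \<Lambda> where "\<Lambda> = ln (2 * real n)"
  define h where "h = ln (1 / \<epsilon>)"
  define Q where "Q = l\<^sup>2 * \<Lambda> + h"
  have ln2: "2/3 \<le> ln (2 :: real)" "ln (2 :: real) \<le> 1"
    using ln2_ge_two_thirds ln_bound[of 2] ln_le_minus_one[of 2] by auto
  have l2: "ln 2 \<le> l" unfolding l_def using \<alpha> by (subst ln_le_cancel_iff) (auto simp: field_simps)
  then have l: "2/3 \<le> l" using ln2 by linarith
  have "ln 2 \<le> \<Lambda>" unfolding \<Lambda>_def using n by (subst ln_le_cancel_iff) auto
  then have \<Lambda>: "2/3 \<le> \<Lambda>" using ln2 by linarith
  have h: "0 \<le> h" unfolding h_def using \<epsilon> by simp
  have Q0: "0 < Q" unfolding Q_def using l \<Lambda> h by (intro add_pos_nonneg mult_pos_pos) auto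
  have mQ: "20000000 * Q \<le> \<alpha> * real m"
    using m \<alpha> unfolding Q_def l_def \<Lambda>_def h_def by (simp add: field_simps)
  then have m0: "0 < m" using Q0 by (cases "m = 0") auto
  define I where "I = nat \<lceil>log 2 (8 / \<alpha>)\<rceil>"
  have log0: "0 \<le> log 2 (8 / \<alpha>)" using \<alpha> by (simp add: field_simps)
  have I1: "(1/2) ^ I \<le> \<alpha> / 8"
  proof -
    have "8 / \<alpha> = 2 powr log 2 (8 / \<alpha>)" using \<alpha> by simp
    also have "\<dots> \<le> 2 powr real I" unfolding I_def by (intro powr_mono) linarith+
    also have "\<dots> = 2 ^ I" by (simp add: powr_realpow)
    finally show ?thesis using \<alpha> by (simp add: field_simps)
  qed
  have I2: "real I \<le> 6 * l"
  proof -
    have "real I \<le> log 2 (8 / \<alpha>) + 1" using log0 unfolding I_def by linarith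
    also have "log 2 (8 / \<alpha>) = (2 * ln 2 + l) / ln 2"
    proof -
      have "8 / \<alpha> = 2 ^ 2 * (2 / \<alpha>)" by simp
      then have "ln (8 / \<alpha>) = 2 * ln 2 + l" unfolding l_def using \<alpha>
        by (simp only: ln_mult ln_realpow) (simp add: ln_mult ln_realpow)
      then show ?thesis by (simp add: log_def)
    qed
    also have "(2 * ln 2 + l) / ln 2 \<le> 9/2 * l"
    proof -
      have "2 * ln 2 + l \<le> 3 * l" using l2 by simp
      also have "\<dots> \<le> (9/2 * l) * ln 2" using mult_left_mono[OF ln2(1), of "9/2 * l"] l by simp
      finally show ?thesis using ln2 by (simp add: field_simps)
    qed
    finally show ?thesis using l by simp
  qed
  define g where "g = ln (192 / \<alpha>)"
  have g: "0 < g" "g \<le> 8 * l"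
  proof -
    have "g = ln 96 + l" unfolding g_def l_def using \<alpha> ln_mult[of 96 "2 / \<alpha>"] by simp
    moreover have "ln (96 :: real) \<le> ln (2 ^ 7)" by (subst ln_le_cancel_iff) auto
    moreover have "ln ((2 :: real) ^ 7) = 7 * ln 2" by (subst ln_realpow) auto
    ultimately show "g \<le> 8 * l" using l2 by linarith
    show "0 < g" unfolding g_def using \<alpha> by (intro ln_gt_zero) (simp add: field_simps)
  qed
  \<comment> \<open>With threshold \<open>u\<^sup>2 = 2\<^sup>-\<^sup>i / 64\<close> the exponent \<open>L u\<^sup>2 / 256\<close> is at least \<open>g\<close>, and \<open>8 exp (- g) = \<alpha>/24\<close>.\<close>
  define L where "L = (\<lambda>i. nat \<lceil>16384 * 2 ^ i * g\<rceil>)"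
  have Lge: "16384 * 2 ^ i * g \<le> real (L i)" and Lle: "real (L i) \<le> 16384 * 2 ^ i * g + 1" for i
  proof -
    have "0 \<le> 16384 * 2 ^ i * g" using g by simp
    then show "16384 * 2 ^ i * g \<le> real (L i)" "real (L i) \<le> 16384 * 2 ^ i * g + 1"
      unfolding L_def by linarith+
  qed
  have L0: "0 < L i" for i
  proof -
    have "0 < 16384 * 2 ^ i * g" using g by simp
    then show ?thesis using Lge[of i] by linarith
  qed
  \<comment> \<open>the three summands cancel the number of averages, produce the factor \<open>2\<^sup>-\<^sup>i\<close>, and produce \<open>\<epsilon>\<close>\<close>
  define \<eta> where "\<eta> = (\<lambda>i. 2 / real m * (real (L i) * ln (4 * real n) + real i * ln 2 + h))"
  have ln4n: "ln (4 * real n) \<le> 2 * \<Lambda>" "0 \<le> ln (4 * real n)"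
  proof -
    have "ln (4 * real n) = ln 2 + \<Lambda>" unfolding \<Lambda>_def using n ln_mult[of 2 "2 * real n"] by simp
    then show "ln (4 * real n) \<le> 2 * \<Lambda>" "0 \<le> ln (4 * real n)" using \<open>ln 2 \<le> \<Lambda>\<close> ln2 by linarith+
  qed
  have fail: "(4 * real n) ^ L i * exp (- (real m * \<eta> i / 2)) = (1/2) ^ i * \<epsilon>" for i
  proof -
    have e1: "real m * \<eta> i / 2 = real (L i) * ln (4 * real n) + real i * ln 2 + h"
      unfolding \<eta>_def using m0 by simp
    have e2: "exp (- (real (L i) * ln (4 * real n) + real i * ln 2 + h))
        = inverse ((4 * real n) ^ L i) * (1/2) ^ i * \<epsilon>"
      using n \<epsilon> by (simp add: exp_add exp_minus exp_of_nat_mult h_def exp_diff ln_div power_divide field_simps)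
    show ?thesis unfolding e1 e2 using n by (simp add: field_simps)
  qed
  note geo = sum_half_powers_le_1[of I]
  have failsum: "(\<Sum>i=1..I. (4 * real n) ^ L i * exp (- (real m * \<eta> i / 2))) \<le> \<epsilon>"
    unfolding fail sum_distrib_right[symmetric] using geo \<epsilon> by (intro mult_left_le_one_le sum_nonneg) auto
  have \<eta>sum: "(\<Sum>i=1..I. (1/2) ^ i * \<eta> i) \<le> \<alpha> / 4"
  proof -
    have term_le: "(1/2) ^ i * \<eta> i \<le> 2 / real m * (262160 * (l * \<Lambda>) + (1/2) ^ i * h)" for i
    proof -
      have p: "0 < (1/2 :: real) ^ i" "(1/2 :: real) ^ i * 2 ^ i = 1" "(1/2 :: real) ^ i \<le> 1"
        by (auto simp: power_mult_distrib[symmetric] power_le_one)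
      have "(1/2) ^ i * real (L i) \<le> (1/2) ^ i * (16384 * 2 ^ i * g + 1)"
        by (intro mult_left_mono Lle) auto
      also have "\<dots> = 16384 * g * ((1/2) ^ i * 2 ^ i) + (1/2) ^ i" by (simp add: algebra_simps)
      also have "\<dots> \<le> 16384 * g + 1" unfolding p(2) using p(3) by simp
      also have "\<dots> \<le> 131075 * l" using g l by simp
      finally have "(1/2) ^ i * real (L i) \<le> 131075 * l" .
      from mult_mono[OF this ln4n(1)]
      have "(1/2) ^ i * real (L i) * ln (4 * real n) \<le> 131075 * l * (2 * \<Lambda>)"
        using ln4n(2) l by simp
      moreover have "(1/2) ^ i * (real i * ln 2) \<le> 1"
      proof -
        have "real i \<le> 2 ^ i" using less_exp[of i] by (simp add: of_nat_less_two_power less_imp_le)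
        then have "real i * ln 2 \<le> 2 ^ i * 1" using ln2 by (intro mult_mono) auto
        then have "(1/2) ^ i * (real i * ln 2) \<le> (1/2) ^ i * 2 ^ i" using p(1) by simp
        then show ?thesis using p(2) by simp
      qed
      moreover have "4/9 \<le> l * \<Lambda>" using mult_mono[of "2/3" l "2/3" \<Lambda>] l \<Lambda> by simp
      ultimately have "(1/2) ^ i * (real (L i) * ln (4 * real n) + real i * ln 2 + h)
          \<le> 262160 * (l * \<Lambda>) + (1/2) ^ i * h"
        by (simp add: distrib_left)
      then have "2 / real m * ((1/2) ^ i * (real (L i) * ln (4 * real n) + real i * ln 2 + h))
          \<le> 2 / real m * (262160 * (l * \<Lambda>) + (1/2) ^ i * h)" by (intro mult_left_mono) auto
      then show ?thesis unfolding \<eta>_def by (simp only: mult.left_commute)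
    qed
    have "(\<Sum>i=1..I. (1/2) ^ i * \<eta> i) \<le> (\<Sum>i=1..I. 2 / real m * (262160 * (l * \<Lambda>) + (1/2) ^ i * h))"
      by (intro sum_mono term_le)
    also have "\<dots> = 2 / real m * (real I * (262160 * (l * \<Lambda>)) + (\<Sum>i=1..I. (1/2) ^ i) * h)"
    proof -
      have "(\<Sum>i=1..I. 262160 * (l * \<Lambda>) + (1/2) ^ i * h)
          = real I * (262160 * (l * \<Lambda>)) + (\<Sum>i=1..I. (1/2) ^ i) * h"
        unfolding sum.distrib sum_distrib_right by simp
      then show ?thesis unfolding sum_distrib_left[symmetric] by (rule arg_cong)
    qed
    also have "\<dots> \<le> 2 / real m * (6 * l * (262160 * (l * \<Lambda>)) + 1 * h)"
      using I2 geo h l \<Lambda> by (intro mult_left_mono add_mono mult_right_mono) auto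
    also have "\<dots> \<le> 2 / real m * (1600000 * Q)"
    proof (intro mult_left_mono)
      have "0 \<le> l\<^sup>2 * \<Lambda>" using \<Lambda> by simp
      then show "6 * l * (262160 * (l * \<Lambda>)) + 1 * h \<le> 1600000 * Q"
        unfolding Q_def using h by (simp add: power2_eq_square algebra_simps)
    qed auto
    also have "\<dots> \<le> \<alpha> / 4"
      using mQ m0 Q0 by (simp add: field_simps)
    finally show ?thesis .
  qed
  have \<delta>: "8 * exp (- (real (L i) * (1/2) ^ i / 16384)) \<le> \<alpha> / 24" for i
  proof -
    have "g = (1/2) ^ i * (16384 * 2 ^ i * g) / 16384" by (simp add: power_divide)
    also have "\<dots> \<le> (1/2) ^ i * real (L i) / 16384"
      by (intro divide_right_mono mult_left_mono Lge) auto
    finally have "exp (- (real (L i) * (1/2) ^ i / 16384)) \<le> exp (- g)" by (simp add: mult.commute)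
    also have "exp (- g) = \<alpha> / 192" unfolding g_def using \<alpha> by (simp add: exp_minus)
    finally show ?thesis by simp
  qed
  obtain E where E: "E \<in> sets (PiM {..<m} (\<lambda>_. M))"
    "1 - (\<Sum>i=1..I. (4 * real n) ^ L i * exp (- (real m * \<eta> i / 2))) \<le> measure (PiM {..<m} (\<lambda>_. M)) E"
    and E2: "\<forall>x\<in>E. (\<forall>k<m. \<forall>j<n. cmod (\<psi> j (x k)) \<le> 1) \<and>
      (\<forall>i\<in>{1..I}. \<forall>\<zeta>\<in>PiE {..<L i} (\<lambda>_. atoms n).
        prob {t \<in> space M. 7/8 * sqrt ((1/2) ^ i) < cmod (atom_average \<psi> (L i) \<zeta> t)}
        \<le> 2 * (\<Sum>k<m. of_bool (7/8 * sqrt ((1/2) ^ i) < cmod (atom_average \<psi> (L i) \<zeta> (x k)))) / m + \<eta> i)"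
    using good_sample_event[OF meas bdd m0, where I = I and L = L and \<eta> = \<eta>]
    by (elim bexE conjE) (rule that)
  show ?thesis
  proof (intro bexI[OF _ E(1)] conjI ballI allI impI)
    show "1 - \<epsilon> \<le> measure (PiM {..<m} (\<lambda>_. M)) E" using E(2) failsum by linarith
    fix x v assume x: "x \<in> E" and v: "(\<Sum>j<n. cmod (v j)) \<le> 1"
      and big: "\<alpha> \<le> (\<integral>t. (cmod (lincomb \<psi> {..<n} v t))\<^sup>2 \<partial>M)"
    have "(\<integral>t. (cmod (lincomb \<psi> {..<n} v t))\<^sup>2 \<partial>M)
        \<le> 8 * ((\<Sum>k<m. (cmod (lincomb \<psi> {..<n} v (x k)))\<^sup>2) / m)
          + (1/2) ^ I + 3 * (\<alpha> / 24) + (\<Sum>i=1..I. (1/2) ^ i * \<eta> i)"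
    proof (rule sampled_square_mean_lower_bound[OF meas bdd _ n m0 v L0 _ \<delta>])
      show "cmod (\<psi> j (x k)) \<le> 1" if "k < m" "j < n" for k j
        using E2 x that by blast
      show "prob {t \<in> space M. 7/8 * sqrt ((1/2) ^ i) < cmod (atom_average \<psi> (L i) \<zeta> t)}
        \<le> 2 * (\<Sum>k<m. of_bool (7/8 * sqrt ((1/2) ^ i) < cmod (atom_average \<psi> (L i) \<zeta> (x k)))) / m + \<eta> i"
        if "i \<in> {1..I}" "\<zeta> \<in> PiE {..<L i} (\<lambda>_. atoms n)" for i \<zeta>
        using bspec[OF bspec[OF conjunct2[OF bspec[OF E2 x]] that(1)] that(2)] .
    qed (use \<alpha> in auto)
    then show "(\<integral>t. (cmod (lincomb \<psi> {..<n} v t))\<^sup>2 \<partial>M) / 16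
        \<le> (\<Sum>k<m. (cmod (lincomb \<psi> {..<n} v (x k)))\<^sup>2) / m"
      using I1 \<eta>sum big by argo
  qed
qed

section \<open>Bounded Riesz bases\<close>

lemma Lp_norm_2_square: "(Lp_norm M 2 f)\<^sup>2 = (\<integral>\<^sup>+ t. ennreal ((cmod (f t))\<^sup>2) \<partial>M)"
proof -
  define J where "J = (\<integral>\<^sup>+ t. ennreal ((cmod (f t))\<^sup>2) \<partial>M)"
  have J: "Lp_norm M 2 f = (if J = \<infinity> then \<infinity> else ennreal (enn2real J powr (1 / 2)))"
    by (simp add: Lp_norm_def J_def Let_def)
  show ?thesis
  proof (cases "J = \<infinity>")
    case True
    then show ?thesis using J J_def by (simp add: power2_eq_square ennreal_mult_top)
  next
    case False
    have "(Lp_norm M 2 f)\<^sup>2 = ennreal (enn2real J)"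
      using J False by (simp add: ennreal_power powr_half_sqrt)
    also have "\<dots> = J" using False by (simp add: top.not_eq_extremum)
    finally show ?thesis by (simp only: J_def)
  qed
qed

lemma lincomb_measurable:
  assumes "\<And>j. \<phi> j \<in> borel_measurable M"
  shows "lincomb \<phi> J c \<in> borel_measurable M"
  unfolding lincomb_def using assms by measurable

lemma bounded_riesz_basis_measurable:
  assumes "bounded_riesz_basis M \<phi> a b K"
  shows "\<phi> j \<in> borel_measurable M"
  using assms by (auto simp: bounded_riesz_basis_def Lp_space_def)

lemma bounded_riesz_basis_AE_bound:
  assumes "bounded_riesz_basis M \<phi> a b K"
  shows "AE t in M. cmod (\<phi> j t) \<le> K"
proof -
  have K: "0 \<le> K" and sup: "(SUP i. Lp_norm M \<infinity> (\<phi> i)) = ennreal K"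
    using assms by (auto simp: bounded_riesz_basis_def)
  have "esssup M (\<lambda>t. ennreal (cmod (\<phi> j t))) \<le> ennreal K"
    unfolding sup[symmetric] by (rule SUP_upper2[of j]) (auto simp: Lp_norm_def)
  note sup_le = this
  show ?thesis
    using esssup_AE[of "\<lambda>t. ennreal (cmod (\<phi> j t))" M]
  proof eventually_elim
    case (elim t)
    then have "ennreal (cmod (\<phi> j t)) \<le> ennreal K" using sup_le by (rule order_trans)
    then show ?case using K by simp
  qed
qed

lemma lincomb_AE_bound:
  assumes "bounded_riesz_basis M \<phi> a b K"
  shows "AE t in M. cmod (lincomb \<phi> {..<n} c t) \<le> K * l1_norm n c"
proof -
  have "AE t in M. \<forall>j. cmod (\<phi> j t) \<le> K"
    unfolding AE_all_countable using bounded_riesz_basis_AE_bound[OF assms] by blast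
  then show ?thesis
  proof eventually_elim
    case (elim t)
    have "cmod (lincomb \<phi> {..<n} c t) \<le> (\<Sum>j<n. cmod (c j) * K)"
      unfolding lincomb_def using elim by (intro sum_norm_le) (auto simp: norm_mult mult_left_mono)
    then show ?case by (simp add: l1_norm_def sum_distrib_left mult.commute)
  qed
qed

text \<open>The Riesz condition speaks of some \<open>L\<^sup>2\<close>-limit of the series; for a finite coefficient sequence the partial sums
  are eventually constant, so this limit is the linear combination itself up to a null set.\<close>

lemma riesz_bounds_nn_integral:
  assumes rb: "bounded_riesz_basis M \<phi> a b K"
  shows "ennreal (a * (l2_norm n c)\<^sup>2) \<le> (\<integral>\<^sup>+ t. ennreal ((cmod (lincomb \<phi> {..<n} c t))\<^sup>2) \<partial>M)"
    and "(\<integral>\<^sup>+ t. ennreal ((cmod (lincomb \<phi> {..<n} c t))\<^sup>2) \<partial>M) \<le> ennreal (b * (l2_norm n c)\<^sup>2)"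
proof -
  note meas = bounded_riesz_basis_measurable[OF rb]
  define d where "d = (\<lambda>j. if j < n then c j else 0)"
  define f where "f = lincomb \<phi> {..<n} c"
  have f: "f \<in> borel_measurable M" unfolding f_def by (rule lincomb_measurable[OF meas])
  have sums: "(\<lambda>i. (cmod (d i))\<^sup>2) sums (\<Sum>i<n. (cmod (d i))\<^sup>2)"
    by (rule sums_finite) (auto simp: d_def)
  have suminf: "(\<Sum>i. (cmod (d i))\<^sup>2) = (l2_norm n c)\<^sup>2"
    using sums_unique[OF sums] by (simp add: l2_norm_eq_norm_sum d_def)
  obtain g where g: "L2_sums M \<phi> d g"
    and lo: "ennreal (a * (l2_norm n c)\<^sup>2) \<le> (Lp_norm M 2 g)\<^sup>2"
    and hi: "(Lp_norm M 2 g)\<^sup>2 \<le> ennreal (b * (l2_norm n c)\<^sup>2)"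
    using rb sums_summable[OF sums] unfolding bounded_riesz_basis_def suminf[symmetric] by blast
  have gm: "g \<in> borel_measurable M" using g by (simp add: L2_sums_def Lp_space_def)
  have "lincomb \<phi> {..<N} d = f" if "n \<le> N" for N
    unfolding f_def lincomb_def d_def fun_eq_iff using that
    by (auto intro!: sum.mono_neutral_cong_right split: if_splits)
  then have "\<forall>\<^sub>F N in sequentially. Lp_norm M 2 (\<lambda>t. g t - lincomb \<phi> {..<N} d t) = Lp_norm M 2 (\<lambda>t. g t - f t)"
    unfolding eventually_sequentially by metis
  then have "(\<lambda>N. Lp_norm M 2 (\<lambda>t. g t - lincomb \<phi> {..<N} d t)) \<longlonglongrightarrow> Lp_norm M 2 (\<lambda>t. g t - f t)"
    by (rule tendsto_eventually)
  then have "Lp_norm M 2 (\<lambda>t. g t - f t) = 0"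
    using g LIMSEQ_unique unfolding L2_sums_def by blast
  then have "(\<integral>\<^sup>+ t. ennreal ((cmod (g t - f t))\<^sup>2) \<partial>M) = 0"
    unfolding Lp_norm_2_square[symmetric] by simp
  then have "AE t in M. ennreal ((cmod (g t - f t))\<^sup>2) = 0"
    using f gm by (subst (asm) nn_integral_0_iff_AE) auto
  then have "AE t in M. g t = f t" by eventually_elim simp
  then have "(Lp_norm M 2 g)\<^sup>2 = (\<integral>\<^sup>+ t. ennreal ((cmod (f t))\<^sup>2) \<partial>M)"
    unfolding Lp_norm_2_square by (intro nn_integral_cong_AE) (auto elim: eventually_mono)
  then show "ennreal (a * (l2_norm n c)\<^sup>2) \<le> (\<integral>\<^sup>+ t. ennreal ((cmod (lincomb \<phi> {..<n} c t))\<^sup>2) \<partial>M)"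
    "(\<integral>\<^sup>+ t. ennreal ((cmod (lincomb \<phi> {..<n} c t))\<^sup>2) \<partial>M) \<le> ennreal (b * (l2_norm n c)\<^sup>2)"
    using lo hi by (simp_all add: f_def)
qed

lemma (in prob_space) lincomb_square_integral:
  assumes rb: "bounded_riesz_basis M \<phi> a b K"
  shows "a * (l2_norm n c)\<^sup>2 \<le> (\<integral>t. (cmod (lincomb \<phi> {..<n} c t))\<^sup>2 \<partial>M)"
    and "(\<integral>t. (cmod (lincomb \<phi> {..<n} c t))\<^sup>2 \<partial>M) \<le> (K * l1_norm n c)\<^sup>2"
proof -
  note [measurable] = lincomb_measurable[OF bounded_riesz_basis_measurable[OF rb]]
  have le: "AE t in M. (cmod (lincomb \<phi> {..<n} c t))\<^sup>2 \<le> (K * l1_norm n c)\<^sup>2"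
    using lincomb_AE_bound[OF rb, of n c] by eventually_elim (simp add: power_mono)
  have int: "integrable M (\<lambda>t. (cmod (lincomb \<phi> {..<n} c t))\<^sup>2)"
    using le by (intro integrable_const_bound[where B = "(K * l1_norm n c)\<^sup>2"]) auto
  have "ennreal (a * (l2_norm n c)\<^sup>2) \<le> ennreal (\<integral>t. (cmod (lincomb \<phi> {..<n} c t))\<^sup>2 \<partial>M)"
    using riesz_bounds_nn_integral(1)[OF rb, of n c] nn_integral_eq_integral[OF int] by simp
  then show "a * (l2_norm n c)\<^sup>2 \<le> (\<integral>t. (cmod (lincomb \<phi> {..<n} c t))\<^sup>2 \<partial>M)"
    by (simp add: ennreal_le_iff)
  have "(\<integral>t. (cmod (lincomb \<phi> {..<n} c t))\<^sup>2 \<partial>M) \<le> (\<integral>t. (K * l1_norm n c)\<^sup>2 \<partial>M)"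
    using int le by (intro integral_mono_AE) auto
  then show "(\<integral>t. (cmod (lincomb \<phi> {..<n} c t))\<^sup>2 \<partial>M) \<le> (K * l1_norm n c)\<^sup>2"
    by (simp add: prob_space)
qed

text \<open>The Riesz bounds applied to \<open>\<phi>\<^sub>0\<close>.\<close>

lemma (in prob_space) riesz_constants:
  assumes rb: "bounded_riesz_basis M \<phi> a b K"
  shows "0 < a" "a \<le> b" "a \<le> K\<^sup>2" "0 < K"
proof -
  show a: "0 < a" using rb by (simp add: bounded_riesz_basis_def)
  have b: "0 < b" "0 \<le> K" using rb by (auto simp: bounded_riesz_basis_def)
  define e where "e = (\<lambda>i :: nat. if i = 0 then 1 else 0 :: complex)"
  have e: "l2_norm 1 e = 1" "l1_norm 1 e = 1" by (simp_all add: l2_norm_def l1_norm_def e_def L2_set_def)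
  have "ennreal a \<le> ennreal b"
    using order_trans[OF riesz_bounds_nn_integral[OF rb, of 1 e]] e by simp
  then show "a \<le> b" using b by simp
  show aK: "a \<le> K\<^sup>2"
    using order_trans[OF lincomb_square_integral[OF rb, of 1 e]] e by simp
  show "0 < K" using a aK b by (cases "K = 0") auto
qed

section \<open>The null space property of random samples\<close>

text \<open>If the inequality fails without the term \<open>A v\<close>, then \<open>\<parallel>v\<parallel>\<^sub>1 \<le> 3 \<surd>s \<parallel>v\<^sub>S\<parallel>\<^sub>2\<close>. By the lower Riesz bound the function
  with coefficients \<open>v\<close>, normalized by \<open>K \<parallel>v\<parallel>\<^sub>1\<close>, then has mean square at least \<open>a / (9 s K\<^sup>2)\<close>, so the sampled mean is
  comparable and \<open>\<parallel>A v\<parallel>\<^sub>2\<close> is at least \<open>\<surd>a \<parallel>v\<^sub>S\<parallel>\<^sub>2 / 4\<close>.\<close>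

lemma (in prob_space) sampled_null_space_property:
  fixes m n s :: nat and a b K :: real and x :: "nat \<Rightarrow> 'a"
  assumes rb: "bounded_riesz_basis M \<phi> a b K" and s: "0 < s" and m: "0 < m"
  defines "\<psi> \<equiv> \<lambda>j t. \<phi> j t / complex_of_real K"
  assumes lower: "\<And>v. (\<Sum>j<n. cmod (v j)) \<le> 1 \<Longrightarrow>
      a / (9 * s * K\<^sup>2) \<le> (\<integral>t. (cmod (lincomb \<psi> {..<n} v t))\<^sup>2 \<partial>M) \<Longrightarrow>
      (\<integral>t. (cmod (lincomb \<psi> {..<n} v t))\<^sup>2 \<partial>M) / 16 \<le> (\<Sum>k<m. (cmod (lincomb \<psi> {..<n} v (x k)))\<^sup>2) / m"
  shows "robust_null_space_property m n s (1/2) (4 / sqrt a) (\<lambda>i j. \<phi> j (x i) / complex_of_real (sqrt (real m)))"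
  unfolding robust_null_space_property_def
proof (intro allI impI)
  fix v S assume "S \<subseteq> {..<n} \<and> card S \<le> s"
  then have S: "S \<subseteq> {..<n}" "card S \<le> s" by auto
  note rc = riesz_constants[OF rb]
  define q where "q = sqrt (real s)"
  have q: "0 < q" "q\<^sup>2 = s" using s by (auto simp: q_def)
  define D where "D = L2_set (\<lambda>i. cmod (v i)) S"
  define N where "N = (\<Sum>i\<in>{..<n} - S. cmod (v i))"
  define Av where "Av = l2_norm m (\<lambda>i. \<Sum>j<n. \<phi> j (x i) / complex_of_real (sqrt (real m)) * v j)"
  have Av0: "0 \<le> Av" by (simp add: Av_def l2_norm_def)
  have N0: "0 \<le> N" by (simp add: N_def sum_nonneg)
  have Av2: "Av\<^sup>2 = (\<Sum>k<m. (cmod (lincomb \<phi> {..<n} v (x k)))\<^sup>2) / m"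
  proof -
    have "(\<Sum>j<n. \<phi> j (x i) / complex_of_real (sqrt (real m)) * v j)
        = lincomb \<phi> {..<n} v (x i) / complex_of_real (sqrt (real m))" for i
      unfolding lincomb_def sum_divide_distrib by (intro sum.cong) auto
    then show ?thesis
      by (simp add: Av_def l2_norm_eq_norm_sum norm_divide power_divide sum_divide_distrib)
  qed
  have "D \<le> 1/2 / q * N + 4 / sqrt a * Av"
  proof (cases "D \<le> 1/2 / q * N")
    case True
    moreover have "0 \<le> 4 / sqrt a * Av" using rc Av0 by simp
    ultimately show ?thesis by linarith
  next
    case False
    define R where "R = l1_norm n v"
    have NT: "N < 2 * q * D" using False q by (simp add: field_simps)
    have D0: "0 < D" using False N0 q by (meson divide_nonneg_pos less_le_trans mult_nonneg_nonneg not_le zero_le_divide_1_iff zero_le_numeral less_imp_le order_trans)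
    have R: "R \<le> 3 * q * D"
    proof -
      have "(\<Sum>i\<in>S. cmod (v i)) \<le> q * D"
        unfolding q_def D_def using S(2) by (intro sum_le_sqrt_card_L2_set) auto
      then show ?thesis using NT l1_norm_split[OF S(1), of v] by (simp add: R_def N_def)
    qed
    have DV: "D \<le> l2_norm n v"
      unfolding D_def l2_norm_def L2_set_def using S(1)
      by (intro real_sqrt_le_mono sum_mono2) auto
    have R0: "0 < R"
    proof -
      have "D \<le> (\<Sum>i\<in>S. cmod (v i))" unfolding D_def by (intro L2_set_le_sum) auto
      then show ?thesis using D0 N0 l1_norm_split[OF S(1), of v] by (simp add: R_def N_def)
    qed
    define w where "w = (\<lambda>j. v j / of_real R)"
    have lw: "lincomb \<psi> {..<n} w t = lincomb \<phi> {..<n} v t / of_real (K * R)" for t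
      unfolding lincomb_def w_def \<psi>_def sum_divide_distrib by (intro sum.cong) auto
    then have sq: "(cmod (lincomb \<psi> {..<n} w t))\<^sup>2 = (cmod (lincomb \<phi> {..<n} v t))\<^sup>2 / (K * R)\<^sup>2" for t
      by (simp add: norm_divide norm_mult power_divide power_mult_distrib)
    define G where "G = (\<integral>t. (cmod (lincomb \<phi> {..<n} v t))\<^sup>2 \<partial>M)"
    have Gw: "(\<integral>t. (cmod (lincomb \<psi> {..<n} w t))\<^sup>2 \<partial>M) = G / (K * R)\<^sup>2"
      unfolding sq G_def by simp
    have KR: "0 < (K * R)\<^sup>2" using rc R0 by simp
    have Gv: "a * (l2_norm n v)\<^sup>2 \<le> G" unfolding G_def by (rule lincomb_square_integral(1)[OF rb])
    have DG: "a * D\<^sup>2 \<le> G"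
    proof -
      have "a * D\<^sup>2 \<le> a * (l2_norm n v)\<^sup>2"
        using DV D0 rc by (intro mult_left_mono power_mono) auto
      then show ?thesis using Gv by linarith
    qed
    have "G / (K * R)\<^sup>2 / 16 \<le> (\<Sum>k<m. (cmod (lincomb \<psi> {..<n} w (x k)))\<^sup>2) / m"
    proof (unfold Gw[symmetric], rule lower)
      show "(\<Sum>j<n. cmod (w j)) \<le> 1"
        using R0 by (simp add: w_def norm_divide sum_divide_distrib[symmetric] l1_norm_def[symmetric] R_def[symmetric])
      have "R\<^sup>2 \<le> (3 * q * D)\<^sup>2" using R R0 by (intro power_mono) auto
      also have "\<dots> = 9 * s * D\<^sup>2" by (simp add: power_mult_distrib q(2))
      finally have "a * R\<^sup>2 \<le> a * (9 * s * D\<^sup>2)" using rc by (intro mult_left_mono) auto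
      also have "\<dots> \<le> 9 * s * G" using mult_left_mono[OF DG, of "9 * s"] by (simp add: mult_ac)
      finally have "a * R\<^sup>2 \<le> 9 * s * G" .
      then show "a / (9 * s * K\<^sup>2) \<le> (\<integral>t. (cmod (lincomb \<psi> {..<n} w t))\<^sup>2 \<partial>M)"
        unfolding Gw using rc R0 s by (simp add: field_simps power_mult_distrib)
    qed
    also have "\<dots> = Av\<^sup>2 / (K * R)\<^sup>2" unfolding sq Av2 by (simp add: sum_divide_distrib[symmetric])
    finally have "G / (K * R)\<^sup>2 / 16 \<le> Av\<^sup>2 / (K * R)\<^sup>2" .
    moreover have "y / 16 \<le> z" if "y / p / 16 \<le> z / p" "0 < p" for y z p :: real
      using that by (simp add: field_simps)
    ultimately have "G / 16 \<le> Av\<^sup>2" using KR by blast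
    then have "(sqrt a * D / 4)\<^sup>2 \<le> Av\<^sup>2"
      using DG rc by (simp add: power_mult_distrib power_divide)
    then have "sqrt a * D / 4 \<le> Av" using Av0 by (rule power2_le_imp_le)
    then have "D \<le> 4 / sqrt a * Av" using rc by (simp add: field_simps)
    moreover have "0 \<le> 1/2 / q * N" using N0 q by simp
    ultimately show ?thesis by linarith
  qed
  then show "L2_set (\<lambda>i. cmod (v i)) S \<le> 1 / 2 / sqrt (real s) * (\<Sum>i\<in>{..<n} - S. cmod (v i)) +
      4 / sqrt a * l2_norm m (\<lambda>i. \<Sum>j<n. \<phi> j (x i) / complex_of_real (sqrt (real m)) * v j)"
    by (simp add: D_def q_def N_def Av_def)
qed

text \<open>The preceding results apply to \<open>\<phi>\<^sub>j / K\<close> with \<open>\<alpha> = a / (9 s K\<^sup>2)\<close>. The logarithm in the assumption on \<open>m\<close> has the argument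
  \<open>2 K\<^sup>2 s / a \<ge> 2\<close>, so it is comparable to \<open>ln (2/\<alpha>)\<close>.\<close>

lemma (in prob_space) random_sampling_null_space_property:
  fixes m n s :: nat and a b K \<epsilon> :: real
  assumes rb: "bounded_riesz_basis M \<phi> a b K" and \<epsilon>: "0 < \<epsilon>" "\<epsilon> < 1" and s: "1 \<le> s" and n: "1 \<le> n"
    and m: "real m \<ge> 4500000000 * (K\<^sup>2 / a) * real s *
      ((ln (2 * (K\<^sup>2 / a) * real s))\<^sup>2 * ln (2 * real n) + ln (1 / \<epsilon>))"
  shows "0 < m \<and> (\<exists>E\<in>sets (PiM {..<m} (\<lambda>_. M)). 1 - \<epsilon> \<le> measure (PiM {..<m} (\<lambda>_. M)) E \<and>
    (\<forall>x\<in>E. robust_null_space_property m n s (1/2) (4 / sqrt a)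
      (\<lambda>i j. \<phi> j (x i) / complex_of_real (sqrt (real m)))))"
proof -
  note rc = riesz_constants[OF rb]
  note meas = bounded_riesz_basis_measurable[OF rb]
  \<comment> \<open>The constant \<open>9\<close> in \<open>1/\<alpha> = 9 y / 2\<close> costs a factor at most \<open>5\<close> in the logarithm, because \<open>9 \<le> y\<^sup>4\<close>.\<close>
  define y where "y = 2 * (K\<^sup>2 / a) * real s"
  define \<alpha> where "\<alpha> = a / (9 * s * K\<^sup>2)"
  have Ka: "1 \<le> K\<^sup>2 / a" using rc by simp
  have s1: "1 \<le> real s" using s by simp
  have y: "2 \<le> y" unfolding y_def using mult_mono[OF Ka s1] Ka by simp
  have \<alpha>: "0 < \<alpha>" "\<alpha> \<le> 1" "1 / \<alpha> = 9 * (K\<^sup>2 / a) * real s" "2 / \<alpha> = 9 * y"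
  proof -
    show "0 < \<alpha>" unfolding \<alpha>_def using rc s by simp
    show inv: "1 / \<alpha> = 9 * (K\<^sup>2 / a) * real s" unfolding \<alpha>_def using rc s by simp
    show "2 / \<alpha> = 9 * y" using inv by (simp add: y_def)
    have "1 \<le> 1 / \<alpha>" unfolding inv using y by (simp add: y_def)
    then show "\<alpha> \<le> 1" using \<open>0 < \<alpha>\<close> by (simp add: field_simps)
  qed
  have ln2n: "0 < ln (2 * real n)" using n by (intro ln_gt_zero) auto
  have lne: "0 < ln (1 / \<epsilon>)" using \<epsilon> by (intro ln_gt_zero) auto
  have lny: "0 < ln y" using y by (intro ln_gt_zero) auto
  have "ln (2 / \<alpha>) \<le> 5 * ln y"
  proof -
    have "ln (2 / \<alpha>) = ln 9 + ln y" unfolding \<alpha>(4) using y ln_mult[of 9 y] by simp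
    also have "ln 9 \<le> ln (y ^ 4)"
    proof (subst ln_le_cancel_iff)
      have "(2 :: real) ^ 4 \<le> y ^ 4" using y by (intro power_mono) auto
      then show "9 \<le> y ^ 4" by simp
    qed (use y in auto)
    also have "ln (y ^ 4) = 4 * ln y" using y by (subst ln_realpow) auto
    finally show ?thesis by simp
  qed
  moreover have "0 \<le> ln (2 / \<alpha>)" unfolding \<alpha>(4) using y by (intro ln_ge_zero) auto
  ultimately have "(ln (2 / \<alpha>))\<^sup>2 \<le> (5 * ln y)\<^sup>2" by (intro power_mono)
  then have "(ln (2 / \<alpha>))\<^sup>2 * ln (2 * real n) \<le> 25 * ((ln y)\<^sup>2 * ln (2 * real n))"
    using ln2n mult_right_mono[of "(ln (2 / \<alpha>))\<^sup>2" "(5 * ln y)\<^sup>2" "ln (2 * real n)"]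
    by (simp add: power_mult_distrib)
  then have "(ln (2 / \<alpha>))\<^sup>2 * ln (2 * real n) + ln (1 / \<epsilon>)
      \<le> 25 * ((ln y)\<^sup>2 * ln (2 * real n) + ln (1 / \<epsilon>))" using lne by simp
  then have "20000000 * (1 / \<alpha>) * ((ln (2 / \<alpha>))\<^sup>2 * ln (2 * real n) + ln (1 / \<epsilon>))
      \<le> 20000000 * (1 / \<alpha>) * (25 * ((ln y)\<^sup>2 * ln (2 * real n) + ln (1 / \<epsilon>)))"
    by (rule mult_left_mono) (use \<alpha>(1) in simp)
  also have "\<dots> = 4500000000 * (K\<^sup>2 / a) * real s * ((ln y)\<^sup>2 * ln (2 * real n) + ln (1 / \<epsilon>))"
    unfolding \<alpha>(3) by simp
  also have "\<dots> \<le> real m" using m unfolding y_def .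
  finally have m': "20000000 * (1 / \<alpha>) * ((ln (2 / \<alpha>))\<^sup>2 * ln (2 * real n) + ln (1 / \<epsilon>)) \<le> real m" .
  have "0 < 20000000 * (1 / \<alpha>) * ((ln (2 / \<alpha>))\<^sup>2 * ln (2 * real n) + ln (1 / \<epsilon>))"
    using \<alpha>(1) lne ln2n by (intro mult_pos_pos add_nonneg_pos) auto
  then have m0: "0 < m" using m' by (cases "m = 0") auto
  define \<psi> where "\<psi> = (\<lambda>j t. \<phi> j t / complex_of_real K)"
  have \<psi>m: "\<psi> j \<in> borel_measurable M" for j unfolding \<psi>_def using meas by measurable
  have "AE t in M. \<forall>j. cmod (\<phi> j t) \<le> K"
    unfolding AE_all_countable using bounded_riesz_basis_AE_bound[OF rb] by blast
  then have \<psi>b: "AE t in M. \<forall>j<n. cmod (\<psi> j t) \<le> 1"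
    by eventually_elim (use rc in \<open>auto simp: \<psi>_def norm_divide\<close>)
  obtain E where E: "E \<in> sets (PiM {..<m} (\<lambda>_. M))" "1 - \<epsilon> \<le> measure (PiM {..<m} (\<lambda>_. M)) E"
    and lower: "\<forall>x\<in>E. \<forall>v. (\<Sum>j<n. cmod (v j)) \<le> 1 \<longrightarrow>
      \<alpha> \<le> (\<integral>t. (cmod (lincomb \<psi> {..<n} v t))\<^sup>2 \<partial>M) \<longrightarrow>
      (\<integral>t. (cmod (lincomb \<psi> {..<n} v t))\<^sup>2 \<partial>M) / 16 \<le> (\<Sum>k<m. (cmod (lincomb \<psi> {..<n} v (x k)))\<^sup>2) / m"
    using uniform_lower_bound_on_l1_ball[OF \<psi>m \<psi>b _ \<alpha>(1,2) \<epsilon> m'] n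
    by (elim meta_impE bexE conjE) (simp, rule that)
  have "robust_null_space_property m n s (1/2) (4 / sqrt a)
      (\<lambda>i j. \<phi> j (x i) / complex_of_real (sqrt (real m)))" if x: "x \<in> E" for x
    using rb _ m0
  proof (rule sampled_null_space_property)
    show "0 < s" using s by simp
  qed (use lower x in \<open>unfold \<psi>_def \<alpha>_def, blast\<close>)
  then show ?thesis using m0 E by blast
qed

section \<open>Error bounds for all exponents\<close>

lemma Lp_norm_eq_0:
  assumes "AE t in M. h t = 0" and h: "h \<in> borel_measurable M"
  shows "Lp_norm M p h = 0"
proof (cases "p = \<infinity>")
  case True
  have "esssup M (\<lambda>t. ennreal (cmod (h t))) \<le> 0"
    using assms by (intro esssup_I) (auto elim: eventually_mono)
  then show ?thesis using True by (simp add: Lp_norm_def)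
next
  case False
  have "(\<integral>\<^sup>+ t. ennreal (cmod (h t) powr enn2real p) \<partial>M) = (\<integral>\<^sup>+ t. 0 \<partial>M)"
    using assms(1) by (intro nn_integral_cong_AE) (auto elim: eventually_mono)
  then show ?thesis using False by (simp add: Lp_norm_def Let_def)
qed

text \<open>Hoelder's inequality in its simplest form, \<open>|h|\<^sup>p \<le> B\<^sup>p\<^sup>-\<^sup>2 |h|\<^sup>2\<close>. With \<open>1 / \<infinity> = 0\<close> the same expression covers
  \<open>p = \<infinity>\<close>.\<close>

lemma Lp_norm_le_interpolation:
  assumes h[measurable]: "h \<in> borel_measurable M" and p: "2 \<le> p"
    and B: "0 < B" "AE t in M. cmod (h t) \<le> B"
    and W: "0 < W" "(\<integral>\<^sup>+ t. ennreal ((cmod (h t))\<^sup>2) \<partial>M) \<le> ennreal W"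
  shows "Lp_norm M p h \<le> ennreal (W powr enn2real (1 / p) * B powr (1 - 2 * enn2real (1 / p)))"
proof (cases "p = \<infinity>")
  case True
  have "esssup M (\<lambda>t. ennreal (cmod (h t))) \<le> ennreal B"
    using B by (intro esssup_I) (auto elim!: eventually_mono intro: ennreal_leI)
  then show ?thesis using True B W by (simp add: Lp_norm_def ennreal_divide_top)
next
  case False
  define r where "r = enn2real p"
  have pr: "p = ennreal r" using False unfolding r_def by (simp add: top.not_eq_extremum)
  have r: "2 \<le> r" 
  proof -
    have "ennreal 2 \<le> ennreal r" using p pr by simp
    then show ?thesis by (metis ennreal_le_iff2 not_numeral_le_zero)
  qed
  have q: "enn2real (1 / p) = 1 / r"
    unfolding pr using r by (simp add: divide_ennreal[of 1, simplified])
  define J where "J = (\<integral>\<^sup>+ t. ennreal (cmod (h t) powr r) \<partial>M)"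
  have "J \<le> (\<integral>\<^sup>+ t. ennreal (B powr (r - 2)) * ennreal ((cmod (h t))\<^sup>2) \<partial>M)"
    unfolding J_def
  proof (rule nn_integral_mono_AE)
    show "AE t in M. ennreal (cmod (h t) powr r) \<le> ennreal (B powr (r - 2)) * ennreal ((cmod (h t))\<^sup>2)"
      using B(2)
    proof eventually_elim
      case (elim t)
      have "cmod (h t) powr r = cmod (h t) powr (r - 2) * cmod (h t) powr 2"
        unfolding powr_add[symmetric] by simp
      also have "\<dots> = cmod (h t) powr (r - 2) * (cmod (h t))\<^sup>2" by simp
      also have "\<dots> \<le> B powr (r - 2) * (cmod (h t))\<^sup>2"
        using elim r by (intro mult_right_mono powr_mono2) auto
      finally show ?case by (simp add: ennreal_mult[symmetric] ennreal_leI)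
    qed
  qed
  also have "\<dots> = ennreal (B powr (r - 2)) * (\<integral>\<^sup>+ t. ennreal ((cmod (h t))\<^sup>2) \<partial>M)"
    by (intro nn_integral_cmult) auto
  also have "\<dots> \<le> ennreal (B powr (r - 2)) * ennreal W"
    using W by (intro mult_left_mono) auto
  finally have J: "J \<le> ennreal (B powr (r - 2) * W)" using W by (simp add: ennreal_mult)
  then have Jfin: "J \<noteq> \<infinity>" by (auto simp: top_unique)
  have "enn2real J \<le> B powr (r - 2) * W" using J W by (intro enn2real_leI) auto
  then have "enn2real J powr (1 / r) \<le> (B powr (r - 2) * W) powr (1 / r)"
    using r by (intro powr_mono2) auto
  also have "\<dots> = W powr (1 / r) * B powr ((r - 2) * (1 / r))"
    using W by (simp add: powr_mult powr_powr mult.commute)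
  also have "(r - 2) * (1 / r) = 1 - 2 * (1 / r)" using r by (simp add: field_simps)
  finally have "enn2real J powr (1 / r) \<le> W powr (1 / r) * B powr (1 - 2 * (1 / r))" .
  moreover have "Lp_norm M p h = ennreal (enn2real J powr (1 / r))"
    using False Jfin by (simp add: Lp_norm_def Let_def J_def r_def)
  ultimately show ?thesis unfolding q by (simp add: ennreal_leI)
qed

text \<open>The number \<open>e\<close> bounds the tail \<open>f - f\<^sub>n\<close> almost everywhere and at the sampling points, whether it comes from the
  supremum or from the essential supremum. With \<open>X = \<sigma> / \<surd>s + e / \<surd>a\<close> the error is at most \<open>400 K \<surd>s X\<close> in \<open>L\<^sup>\<infinity>\<close> and at most
  \<open>400 \<surd>b X\<close> in \<open>L\<^sup>2\<close>; the tail itself is absorbed by \<open>e \<le> \<surd>a X\<close> and \<open>a \<le> b\<close>, \<open>a \<le> K\<^sup>2\<close>.\<close>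

lemma (in prob_space) recovery_error_Lp:
  fixes m n s :: nat and a b K e :: real and x :: "nat \<Rightarrow> 'a"
  assumes rb: "bounded_riesz_basis M \<phi> a b K" and s: "0 < s" and m: "0 < m"
    and nsp: "robust_null_space_property m n s (1/2) (4 / sqrt a)
      (\<lambda>i j. \<phi> j (x i) / complex_of_real (sqrt (real m)))"
    and f: "f \<in> borel_measurable M" and e: "0 \<le> e"
    and tail: "AE t in M. cmod (f t - lincomb \<phi> {..<n} c t) \<le> e"
    and samples: "\<And>k. k < m \<Longrightarrow> cmod (f (x k) - lincomb \<phi> {..<n} c (x k)) \<le> e"
    and g: "g \<in> sparse_recovery \<phi> a s n m x f" and p: "2 \<le> p"
  defines "q \<equiv> enn2real (1 / p)"
  shows "Lp_norm M p (\<lambda>t. f t - g t) \<le> ennreal (400 * b powr q * K powr (1 - 2 * q)) *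
    (ennreal (sigma1 n s c / real s powr q) + ennreal (real s powr (1 / 2 - q) / sqrt a) * ennreal e)"
proof -
  note rc = riesz_constants[OF rb]
  have [measurable]: "lincomb \<phi> J d \<in> borel_measurable M" for J d
    by (rule lincomb_measurable[OF bounded_riesz_basis_measurable[OF rb]])
  note [measurable] = f
  define A where "A = (\<lambda>i j. \<phi> j (x i) / complex_of_real (sqrt (real m)))"
  define y where "y = (\<lambda>i. f (x i) / complex_of_real (sqrt (real m)))"
  obtain d where gd: "g = lincomb \<phi> {..<n} d"
    and d: "d \<in> hard_thresholdings n (2 * s) (min_norm_lasso (3 / 14 * sqrt (a / real s)) m n A y)"
    using g unfolding sparse_recovery_def A_def y_def Let_def by blast
  have res: "l2_norm m (\<lambda>i. (\<Sum>j<n. A i j * c j) - y i) \<le> e"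
  proof -
    have "(\<Sum>j<n. A i j * c j) - y i
        = (lincomb \<phi> {..<n} c (x i) - f (x i)) / complex_of_real (sqrt (real m))" for i
    proof -
      have "(\<Sum>j<n. A i j * c j) = lincomb \<phi> {..<n} c (x i) / complex_of_real (sqrt (real m))"
        unfolding lincomb_def A_def sum_divide_distrib by (intro sum.cong) auto
      then show ?thesis by (simp add: y_def diff_divide_distrib)
    qed
    then have "(l2_norm m (\<lambda>i. (\<Sum>j<n. A i j * c j) - y i))\<^sup>2
        = (\<Sum>k<m. (cmod (f (x k) - lincomb \<phi> {..<n} c (x k)))\<^sup>2) / m"
      by (simp add: l2_norm_eq_norm_sum norm_divide power_divide sum_divide_distrib norm_minus_commute)
    also have "\<dots> \<le> (\<Sum>k<m. e\<^sup>2) / m"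
      using samples by (intro divide_right_mono sum_mono power_mono) auto
    also have "\<dots> = e\<^sup>2" using m by simp
    finally show ?thesis using e by (rule power2_le_imp_le)
  qed
  define X where "X = sigma1 n s c / sqrt (real s) + e / sqrt a"
  define u where "u = (\<lambda>i. c i - d i)"
  have l1: "l1_norm n u \<le> 171 * sqrt (real s) * X" and l2: "l2_norm n u \<le> 270 * X"
    unfolding u_def X_def using sparse_vector_recovery[OF rc(1) s nsp[folded A_def] res d] by auto
  have sg: "0 \<le> sigma1 n s c"
    unfolding sigma1_def
    by (rule cINF_greatest) (auto simp: l1_norm_def sum_nonneg sparse_def cvec_def intro!: exI[of _ "\<lambda>_. 0"])
  have X0: "0 \<le> X" unfolding X_def using sg e rc by simp
  have eX: "e \<le> sqrt a * X" unfolding X_def using sg rc s by (simp add: field_simps)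
  define h where "h = (\<lambda>t. f t - g t)"
  have h[measurable]: "h \<in> borel_measurable M" unfolding h_def gd by measurable
  have hsplit: "h t = (f t - lincomb \<phi> {..<n} c t) + lincomb \<phi> {..<n} u t" for t
    unfolding h_def gd u_def lincomb_def by (simp add: algebra_simps sum_subtractf)
  define r where "r = sqrt (real s)"
  have r: "1 \<le> r" using s by (simp add: r_def)
  have aK: "sqrt a \<le> K" using rc by (intro real_le_lsqrt) auto
  define B where "B = 400 * K * r * X"
  define W where "W = 160000 * b * X\<^sup>2"
  have hB: "AE t in M. cmod (h t) \<le> B"
    using tail lincomb_AE_bound[OF rb, of n u]
  proof eventually_elim
    case (elim t)
    have "cmod (h t) \<le> e + K * l1_norm n u"
      unfolding hsplit using elim norm_triangle_ineq by (meson add_mono order_trans)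
    also have "\<dots> \<le> K * r * X + K * (171 * r * X)"
    proof (intro add_mono mult_left_mono)
      have "sqrt a * X \<le> (K * r) * X"
        using aK r X0 rc by (intro mult_right_mono order_trans[OF aK]) auto
      then show "e \<le> K * r * X" using eX by linarith
    qed (use l1 rc in \<open>auto simp: r_def\<close>)
    also have "\<dots> = 172 * (K * r * X)" by simp
    also have "\<dots> \<le> 400 * (K * r * X)" using rc r X0 by (intro mult_right_mono) auto
    finally show ?case by (simp add: B_def mult_ac)
  qed
  have hW: "(\<integral>\<^sup>+ t. ennreal ((cmod (h t))\<^sup>2) \<partial>M) \<le> ennreal W"
  proof -
    have "(\<integral>\<^sup>+ t. ennreal ((cmod (h t))\<^sup>2) \<partial>M)
        \<le> (\<integral>\<^sup>+ t. ennreal (2 * e\<^sup>2) + 2 * ennreal ((cmod (lincomb \<phi> {..<n} u t))\<^sup>2) \<partial>M)"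
    proof (rule nn_integral_mono_AE)
      show "AE t in M. ennreal ((cmod (h t))\<^sup>2)
          \<le> ennreal (2 * e\<^sup>2) + 2 * ennreal ((cmod (lincomb \<phi> {..<n} u t))\<^sup>2)"
        using tail
      proof eventually_elim
        case (elim t)
        have "cmod (h t) \<le> e + cmod (lincomb \<phi> {..<n} u t)"
          unfolding hsplit using elim norm_triangle_ineq by (meson add_right_mono order_trans)
        then have "(cmod (h t))\<^sup>2 \<le> (e + cmod (lincomb \<phi> {..<n} u t))\<^sup>2"
          by (intro power_mono) auto
        also have "\<dots> \<le> 2 * e\<^sup>2 + 2 * (cmod (lincomb \<phi> {..<n} u t))\<^sup>2"
          using sum_squares_bound[of e "cmod (lincomb \<phi> {..<n} u t)"] by (simp add: power2_sum)
        finally have "ennreal ((cmod (h t))\<^sup>2) \<le> ennreal (2 * e\<^sup>2 + 2 * (cmod (lincomb \<phi> {..<n} u t))\<^sup>2)"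
          by (rule ennreal_leI)
        then show ?case by (simp add: ennreal_plus ennreal_mult)
      qed
    qed
    also have "\<dots> = ennreal (2 * e\<^sup>2) + 2 * (\<integral>\<^sup>+ t. ennreal ((cmod (lincomb \<phi> {..<n} u t))\<^sup>2) \<partial>M)"
      by (subst nn_integral_add) (auto simp: nn_integral_cmult emeasure_space_1)
    also have "\<dots> \<le> ennreal (2 * e\<^sup>2) + 2 * ennreal (b * (l2_norm n u)\<^sup>2)"
      by (intro add_left_mono mult_left_mono riesz_bounds_nn_integral(2)[OF rb]) auto
    also have "\<dots> = ennreal (2 * e\<^sup>2 + 2 * (b * (l2_norm n u)\<^sup>2))"
      using rc by (simp add: ennreal_plus ennreal_mult)
    also have "\<dots> \<le> ennreal W"
    proof (rule ennreal_leI)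
      have "e\<^sup>2 \<le> (sqrt a * X)\<^sup>2" using e eX by (intro power_mono)
      also have "\<dots> = a * X\<^sup>2" using rc by (simp add: power_mult_distrib)
      also have "\<dots> \<le> b * X\<^sup>2" using rc by (intro mult_right_mono) auto
      finally have 1: "e\<^sup>2 \<le> b * X\<^sup>2" .
      have "(l2_norm n u)\<^sup>2 \<le> (270 * X)\<^sup>2" using l2 by (intro power_mono) (auto simp: l2_norm_def)
      then have "b * (l2_norm n u)\<^sup>2 \<le> b * (270 * X)\<^sup>2" using rc by (intro mult_left_mono) auto
      then have 2: "b * (l2_norm n u)\<^sup>2 \<le> 72900 * (b * X\<^sup>2)" by (simp add: power_mult_distrib)
      have "0 \<le> b * X\<^sup>2" using rc by simp
      then show "2 * e\<^sup>2 + 2 * (b * (l2_norm n u)\<^sup>2) \<le> W" using 1 2 by (simp add: W_def)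
    qed
    finally show ?thesis .
  qed
  show ?thesis
  proof (cases "X = 0")
    case True
    then have "AE t in M. h t = 0" using hB by (auto simp: B_def elim: eventually_mono)
    then have "Lp_norm M p h = 0" using h by (rule Lp_norm_eq_0)
    then show ?thesis by (simp add: h_def)
  next
    case False
    then have X: "0 < X" using X0 by simp
    have b: "0 < b" using rc by linarith
    have "Lp_norm M p h \<le> ennreal (W powr q * B powr (1 - 2 * q))"
      unfolding q_def
      by (rule Lp_norm_le_interpolation[OF h p _ hB _ hW])
        (use X b rc r in \<open>auto simp: B_def W_def\<close>)
    also have "W powr q * B powr (1 - 2 * q) = (400 * b powr q * K powr (1 - 2 * q)) * (r powr (1 - 2 * q) * X)"
    proof -
      have "W = (400 * X)\<^sup>2 * b" by (simp add: W_def power_mult_distrib)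
      then have "W powr q = ((400 * X)\<^sup>2) powr q * b powr q"
        using X b by (simp only: powr_mult)
      also have "((400 * X)\<^sup>2) powr q = (400 * X) powr (2 * q)"
        unfolding powr_powr[symmetric] using X by (subst powr_numeral) auto
      finally have "W powr q = (400 * X) powr (2 * q) * b powr q" .
      moreover have "B powr (1 - 2 * q) = K powr (1 - 2 * q) * r powr (1 - 2 * q) * (400 * X) powr (1 - 2 * q)"
      proof -
        have "B = K * r * (400 * X)" by (simp add: B_def)
        then show ?thesis using X rc r by (simp add: powr_mult)
      qed
      moreover have "(400 * X) powr (2 * q) * (400 * X) powr (1 - 2 * q) = 400 * X"
        using X by (simp add: powr_add[symmetric])
      ultimately show ?thesis by (simp add: mult_ac)
    qed
    also have "r powr (1 - 2 * q) = real s powr (1 / 2 - q)"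
      using s by (simp add: r_def powr_half_sqrt[symmetric] powr_powr algebra_simps)
    also have "real s powr (1 / 2 - q) * X
        = sigma1 n s c / real s powr q + real s powr (1 / 2 - q) / sqrt a * e"
    proof -
      have "real s powr (1 / 2 - q) / sqrt (real s) = 1 / real s powr q"
        using s by (simp add: powr_half_sqrt[symmetric] powr_diff)
      moreover have "real s powr (1 / 2 - q) * X = sigma1 n s c * (real s powr (1 / 2 - q) / sqrt (real s))
          + real s powr (1 / 2 - q) / sqrt a * e"
        unfolding X_def by (simp add: distrib_left mult.commute)
      ultimately show ?thesis by simp
    qed
    also have "ennreal (400 * b powr q * K powr (1 - 2 * q) *
          (sigma1 n s c / real s powr q + real s powr (1 / 2 - q) / sqrt a * e))
        = ennreal (400 * b powr q * K powr (1 - 2 * q)) *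
          (ennreal (sigma1 n s c / real s powr q) + ennreal (real s powr (1 / 2 - q) / sqrt a) * ennreal e)"
    proof -
      have product_form: "ennreal (y * (z + w * e)) = ennreal y * (ennreal z + ennreal w * ennreal e)"
        if "0 \<le> y" "0 \<le> z" "0 \<le> w" for y z w :: real
        using that e by (simp add: ennreal_mult ennreal_plus)
      show ?thesis by (rule product_form) (use sg rc in auto)
    qed
    finally show ?thesis by (simp add: h_def)
  qed
qed

text \<open>One event serves all \<open>f\<close>, since the null space property does not involve \<open>f\<close>. For a fixed \<open>f\<close>, almost every
  sample avoids the null set on which the tail of \<open>f\<close> exceeds its essential supremum.\<close>

theorem theorem1p1:
  shows "\<exists>c\<^sub>0 C :: real. 0 < c\<^sub>0 \<and> 0 < C \<and>
    (\<forall>(M :: 'a measure) \<phi> a b K \<epsilon> s n m.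
      prob_space M \<and> bounded_riesz_basis M \<phi> a b K \<and> 0 < \<epsilon> \<and> \<epsilon> < 1 \<and> 1 \<le> s \<and> 1 \<le> n \<and>
      real m \<ge> c\<^sub>0 * (K\<^sup>2 / a) * real s *
        ((ln (2 * (K\<^sup>2 / a) * real s))\<^sup>2 * ln (2 * real n) + ln (1 / \<epsilon>))
      \<longrightarrow>
      (\<exists>E \<in> sets (Pi\<^sub>M {..<m} (\<lambda>_. M)). measure (Pi\<^sub>M {..<m} (\<lambda>_. M)) E \<ge> 1 - \<epsilon> \<and>
        (\<forall>f c. f \<in> Lp_space M 2 \<and> L2_sums M \<phi> c f \<longrightarrow>
          (let r = (\<lambda>t. f t - lincomb \<phi> {..<n} c t);
               bound = (\<lambda>p \<tau>. let q = enn2real (1 / p) in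
                 ennreal (C * b powr q * K powr (1 - 2 * q)) *
                   (ennreal (sigma1 n s c / real s powr q) +
                    ennreal (real s powr (1 / 2 - q) / sqrt a) * \<tau>))
           in
             (\<forall>x\<in>E. \<forall>g\<in>sparse_recovery \<phi> a s n m x f.
               (\<exists>J d. J \<subseteq> {..<n} \<and> card J \<le> 2 * s \<and> g = lincomb \<phi> J d) \<and>
               (\<forall>p\<ge>2. Lp_norm M p (\<lambda>t. f t - g t) \<le> bound p (sup_norm M r))) \<and>
             (AE x in Pi\<^sub>M {..<m} (\<lambda>_. M). x \<in> E \<longrightarrow>
               (\<forall>g\<in>sparse_recovery \<phi> a s n m x f.
                 \<forall>p\<ge>2. Lp_norm M p (\<lambda>t. f t - g t) \<le> bound p (Lp_norm M \<infinity> r)))))))"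
proof -
  have main: "\<exists>E \<in> sets (Pi\<^sub>M {..<m} (\<lambda>_. M)). measure (Pi\<^sub>M {..<m} (\<lambda>_. M)) E \<ge> 1 - \<epsilon> \<and>
        (\<forall>f c. f \<in> Lp_space M 2 \<and> L2_sums M \<phi> c f \<longrightarrow>
          (let r = (\<lambda>t. f t - lincomb \<phi> {..<n} c t);
               bound = (\<lambda>p \<tau>. let q = enn2real (1 / p) in
                 ennreal (400 * b powr q * K powr (1 - 2 * q)) *
                   (ennreal (sigma1 n s c / real s powr q) +
                    ennreal (real s powr (1 / 2 - q) / sqrt a) * \<tau>))
           in
             (\<forall>x\<in>E. \<forall>g\<in>sparse_recovery \<phi> a s n m x f.
               (\<exists>J d. J \<subseteq> {..<n} \<and> card J \<le> 2 * s \<and> g = lincomb \<phi> J d) \<and>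
               (\<forall>p\<ge>2. Lp_norm M p (\<lambda>t. f t - g t) \<le> bound p (sup_norm M r))) \<and>
             (AE x in Pi\<^sub>M {..<m} (\<lambda>_. M). x \<in> E \<longrightarrow>
               (\<forall>g\<in>sparse_recovery \<phi> a s n m x f.
                 \<forall>p\<ge>2. Lp_norm M p (\<lambda>t. f t - g t) \<le> bound p (Lp_norm M \<infinity> r)))))"
    if "prob_space M" and rb: "bounded_riesz_basis M \<phi> a b K" and \<epsilon>: "0 < \<epsilon>" "\<epsilon> < 1"
      and s: "1 \<le> s" and n: "1 \<le> n"
      and m: "real m \<ge> 4500000000 * (K\<^sup>2 / a) * real s *
        ((ln (2 * (K\<^sup>2 / a) * real s))\<^sup>2 * ln (2 * real n) + ln (1 / \<epsilon>))"
    for M :: "'a measure" and \<phi> a b K \<epsilon> s n m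
  proof -
    interpret prob_space M by fact
    interpret P: product_prob_space "\<lambda>_. M" "{..<m}" ..
    note rc = riesz_constants[OF rb]
    have [measurable]: "lincomb \<phi> J d \<in> borel_measurable M" for J d
      by (rule lincomb_measurable[OF bounded_riesz_basis_measurable[OF rb]])
    obtain E where m0: "0 < m" and E: "E \<in> sets (PiM {..<m} (\<lambda>_. M))"
        "1 - \<epsilon> \<le> measure (PiM {..<m} (\<lambda>_. M)) E"
      and nsp: "\<And>x. x \<in> E \<Longrightarrow> robust_null_space_property m n s (1/2) (4 / sqrt a)
          (\<lambda>i j. \<phi> j (x i) / complex_of_real (sqrt (real m)))"
      using random_sampling_null_space_property[OF rb \<epsilon> s n m] by blast
    have s0: "0 < s" using s by simp
    have xk: "x k \<in> space M" if "x \<in> E" "k < m" for x k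
      using sets.sets_into_space[OF E(1)] that by (auto simp: space_PiM)
    define bound where "bound = (\<lambda>c p \<tau>. ennreal (400 * b powr enn2real (1 / p) * K powr (1 - 2 * enn2real (1 / p))) *
      (ennreal (sigma1 n s c / real s powr enn2real (1 / p)) +
        ennreal (real s powr (1 / 2 - enn2real (1 / p)) / sqrt a) * \<tau>))"
    have bound_eq: "ennreal (400 * b powr enn2real (1 / p) * K powr (1 - 2 * enn2real (1 / p))) *
      (ennreal (sigma1 n s c / real s powr enn2real (1 / p)) +
        ennreal (real s powr (1 / 2 - enn2real (1 / p)) / sqrt a) * \<tau>) = bound c p \<tau>" for c p \<tau>
      by (simp only: bound_def)
    \<comment> \<open>an unbounded tail makes the claim void, as all other factors are positive\<close>
    have bound_top: "bound c p \<infinity> = \<infinity>" for c p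
    proof -
      have "0 < 400 * b powr enn2real (1 / p) * K powr (1 - 2 * enn2real (1 / p))"
        "0 < real s powr (1 / 2 - enn2real (1 / p)) / sqrt a"
        using rc s by auto
      moreover have "ennreal u * (v + ennreal w * \<infinity>) = \<infinity>" if "0 < u" "0 < w" for u v w
        using that by (simp add: ennreal_mult_top)
      ultimately show ?thesis unfolding bound_def by blast
    qed
    have error: "Lp_norm M p (\<lambda>t. f t - g t) \<le> bound c p \<tau>"
      if f: "f \<in> borel_measurable M" and x: "x \<in> E" and g: "g \<in> sparse_recovery \<phi> a s n m x f" and p: "2 \<le> p"
        and tail: "AE t in M. ennreal (cmod (f t - lincomb \<phi> {..<n} c t)) \<le> \<tau>"
        and samples: "\<And>k. k < m \<Longrightarrow> ennreal (cmod (f (x k) - lincomb \<phi> {..<n} c (x k))) \<le> \<tau>"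
      for f c x g p \<tau>
    proof (cases "\<tau> = \<infinity>")
      case True
      then show ?thesis by (simp add: bound_top[unfolded infinity_ennreal_def])
    next
      case False
      then obtain e where e: "0 \<le> e" "\<tau> = ennreal e" by (cases \<tau>) auto
      show ?thesis unfolding bound_def e(2)
        by (rule recovery_error_Lp[OF rb s0 m0 nsp[OF x] f e(1) _ _ g p])
          (use tail samples e in \<open>auto simp: ennreal_le_iff elim: eventually_mono\<close>)
    qed
    have sparse: "\<exists>J d. J \<subseteq> {..<n} \<and> card J \<le> 2 * s \<and> g = lincomb \<phi> J d"
      if g: "g \<in> sparse_recovery \<phi> a s n m x f" for g x f
    proof -
      obtain z d where gd: "g = lincomb \<phi> {..<n} d" and d: "d \<in> hard_thresholdings n (2 * s) z"
        using g unfolding sparse_recovery_def Let_def by blast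
      obtain J where J: "d = (\<lambda>i. if i \<in> J then z i else 0)" "J \<subseteq> {..<n}" "card J = min (2 * s) n"
        using d unfolding hard_thresholdings_def by blast
      have "g = lincomb \<phi> J z"
        unfolding gd lincomb_def J(1) fun_eq_iff using J(2)
        by (auto intro!: sum.mono_neutral_cong_right)
      then show ?thesis using J by auto
    qed
    have samples_AE: "AE x in PiM {..<m} (\<lambda>_. M). \<forall>k\<in>{..<m}. P (x k)" if "AE t in M. P t" for P
      using that by (intro AE_finite_allI P.AE_component) auto
    show ?thesis
      unfolding Let_def bound_eq
    proof (intro bexI[OF _ E(1)] conjI allI impI ballI)
      show "1 - \<epsilon> \<le> measure (PiM {..<m} (\<lambda>_. M)) E" by (rule E(2))
      fix f c assume fc: "f \<in> Lp_space M 2 \<and> L2_sums M \<phi> c f"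
      then have f[measurable]: "f \<in> borel_measurable M" by (simp add: Lp_space_def)
      define r where "r = (\<lambda>t. f t - lincomb \<phi> {..<n} c t)"
      show "\<exists>J d. J \<subseteq> {..<n} \<and> card J \<le> 2 * s \<and> g = lincomb \<phi> J d"
        if "g \<in> sparse_recovery \<phi> a s n m x f" for x g using that by (rule sparse)
      have sup: "ennreal (cmod (r t)) \<le> sup_norm M r" if "t \<in> space M" for t
        unfolding sup_norm_def using that by (rule SUP_upper)
      show "Lp_norm M p (\<lambda>t. f t - g t) \<le> bound c p (sup_norm M (\<lambda>t. f t - lincomb \<phi> {..<n} c t))"
        if "x \<in> E" "g \<in> sparse_recovery \<phi> a s n m x f" "2 \<le> p" for x g p
        using f that
      proof (rule error)
        show "AE t in M. ennreal (cmod (f t - lincomb \<phi> {..<n} c t)) \<le> sup_norm M (\<lambda>t. f t - lincomb \<phi> {..<n} c t)"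
          using sup unfolding r_def by (rule AE_I2)
        show "ennreal (cmod (f (x k) - lincomb \<phi> {..<n} c (x k))) \<le> sup_norm M (\<lambda>t. f t - lincomb \<phi> {..<n} c t)"
          if "k < m" for k using sup[OF xk[OF \<open>x \<in> E\<close> that]] unfolding r_def .
      qed
      have ess: "AE t in M. ennreal (cmod (r t)) \<le> Lp_norm M \<infinity> r"
        unfolding Lp_norm_def using esssup_AE[of "\<lambda>t. ennreal (cmod (r t))" M] by simp
      show "AE x in PiM {..<m} (\<lambda>_. M). x \<in> E \<longrightarrow> (\<forall>g\<in>sparse_recovery \<phi> a s n m x f. \<forall>p\<ge>2.
          Lp_norm M p (\<lambda>t. f t - g t) \<le> bound c p (Lp_norm M \<infinity> (\<lambda>t. f t - lincomb \<phi> {..<n} c t)))"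
        using samples_AE[OF ess]
      proof eventually_elim
        case (elim x)
        show ?case
        proof (intro impI ballI allI)
          fix g p assume "x \<in> E" "g \<in> sparse_recovery \<phi> a s n m x f" "(2 :: ennreal) \<le> p"
          with f show "Lp_norm M p (\<lambda>t. f t - g t) \<le> bound c p (Lp_norm M \<infinity> (\<lambda>t. f t - lincomb \<phi> {..<n} c t))"
            by (rule error) (use ess elim in \<open>auto simp: r_def\<close>)
        qed
      qed
    qed
  qed
  show ?thesis
    by (rule exI[of _ 4500000000], rule exI[of _ 400], intro conjI allI impI)
      (simp, simp, elim conjE, rule main, assumption+)
qed

end
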